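(* Let $0<\alpha<n$ and let $p(\cdot)\in\mathcal{P}(\mathbb{R}^n)$ be such that $1\le p_-\le p_+<\frac n\alpha$. Let $q(\cdot)\in\mathcal{P}(\mathbb{R}^n)$ be defined by $\frac1{p(x)}-\frac1{q(x)}=\frac\alpha n$, let $q_0$ be defined by $\frac1{p_-}-\frac1{q_0}=\frac\alpha n$, and suppose that the Hardy–Littlewood maximal operator $\mathcal{M}$ is bounded on $L^{(q(\cdot)/q_0)'}(\mathbb{R}^n)$. If $p_->1$, then there exists $C>0$ such that for all $f\in L^{p(\cdot)}(\mathbb{R}^n)$ $$\|M_\alpha f\|_{q(\cdot)}\le C\|f\|_{p(\cdot)}.$$ If $p_-=1$, then there exists $C>0$ such that for all $f\in L^{p(\cdot)}(\mathbb{R}^n)$ and all $\lambda>0$ $$\left\|\lambda\,\chi_{\{x\in\mathbb{R}^n:\,|M_\alpha f(x)|>\lambda\}}\right\|_{q(\cdot)}\le C\|f\|_{p(\cdot)}.$$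
   Context: $\mathcal{P}(\mathbb{R}^n)$ is the family of measurable functions $p(\cdot):\mathbb{R}^n\to[1,\infty]$. For $p(\cdot)\in\mathcal{P}(\mathbb{R}^n)$ put $E_\infty=\{x\in\mathbb{R}^n:p(x)=\infty\}$ and $$\rho_{p(\cdot)}(f)=\int_{\mathbb{R}^n\setminus E_\infty}|f(x)|^{p(x)}dx+\|f\|_{L^\infty(E_\infty)}.$$ $L^{p(\cdot)}(\mathbb{R}^n)$ is the space of measurable $f$ with $\rho_{p(\cdot)}(f/\lambda)<\infty$ for some $\lambda>0$, with norm $\|f\|_{p(\cdot)}=\inf\{\lambda>0:\rho_{p(\cdot)}(f/\lambda)\le1\}$. Also $p_-=\operatorname{ess\,inf}p(x)$, $p_+=\operatorname{ess\,sup}p(x)$, and $r'(\cdot)$ denotes the pointwise conjugate exponent of $r(\cdot)$, $\frac1{r(x)}+\frac1{r'(x)}=1$ (with $1/\infty=0$). Hardy–Littlewood maximal operator: $\mathcal{M}f(x)=\sup_B\frac1{|B|}\int_B|f(y)|dy$. Fractional maximal operator, $0<\alpha<n$: $M_\alpha f(x)=\sup_B\frac1{|B|^{1-\alpha/n}}\int_B|f(y)|dy$. Both suprema are over all balls $B$ containing $x$. *)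

theory Defs
  imports "HOL-Analysis.Analysis" "HOL-Probability.Essential_Supremum"
begin

definition variable_exponents :: "('a::euclidean_space \<Rightarrow> ereal) set" where
  "variable_exponents = {p \<in> borel_measurable lebesgue. \<forall>x. 1 \<le> p x}"

definition ess_inf :: "('a::euclidean_space \<Rightarrow> ereal) \<Rightarrow> ereal" where
  "ess_inf p = Sup {c. AE x in lebesgue. c \<le> p x}"

definition ess_sup :: "('a::euclidean_space \<Rightarrow> ereal) \<Rightarrow> ereal" where
  "ess_sup p = esssup lebesgue p"

text \<open>Solves \<open>1 / r x + 1 / r' x = 1\<close> for \<open>r' x\<close>. Division in \<^typ>\<open>ereal\<close> gives
  \<open>r' x = \<infinity>\<close> where \<open>r x = 1\<close> and \<open>r' x = 1\<close> where \<open>r x = \<infinity>\<close>.\<close>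

definition conjugate_exponent :: "('a \<Rightarrow> ereal) \<Rightarrow> 'a \<Rightarrow> ereal" where
  "conjugate_exponent r = (\<lambda>x. 1 / (1 - 1 / r x))"

lemma conjugate_exponent_eq:
  assumes "1 \<le> r x"
  shows "1 / r x + 1 / conjugate_exponent r x = 1"
proof (cases "r x")
  case (real a)
  with assms have "1 \<le> a" by simp
  then show ?thesis
    using real by (cases "a = 1")
      (auto simp: conjugate_exponent_def one_ereal_def divide_ereal_def field_simps)
qed (use assms in \<open>auto simp: conjugate_exponent_def one_ereal_def divide_ereal_def\<close>)

text \<open>\<open>x\<^sup>a\<close> for \<open>a > 0\<close>, with \<open>\<infinity>\<^sup>a = \<infinity>\<close>.\<close>

definition ennreal_powr :: "ennreal \<Rightarrow> real \<Rightarrow> ennreal" where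
  "ennreal_powr x a = (if x = \<infinity> then \<infinity> else ennreal (enn2real x powr a))"

text \<open>The modular and the norm take \<open>[0,\<infinity>]\<close>-valued functions, because maximal functions are
  \<open>[0,\<infinity>]\<close>-valued; a real function \<open>f\<close> enters through \<open>\<bar>f\<bar>\<close>.\<close>

definition modular :: "('a::euclidean_space \<Rightarrow> ereal) \<Rightarrow> ('a \<Rightarrow> ennreal) \<Rightarrow> ennreal" where
  "modular p g =
     (\<integral>\<^sup>+ x \<in> {x. p x \<noteq> \<infinity>}. ennreal_powr (g x) (real_of_ereal (p x)) \<partial>lebesgue)
     + esssup (restrict_space lebesgue {x. p x = \<infinity>}) g"

definition Lp_norm :: "('a::euclidean_space \<Rightarrow> ereal) \<Rightarrow> ('a \<Rightarrow> ennreal) \<Rightarrow> ennreal" where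
  "Lp_norm p g = Inf {ennreal l | l::real. 0 < l \<and> modular p (\<lambda>x. g x / ennreal l) \<le> 1}"

definition Lp_space :: "('a::euclidean_space \<Rightarrow> ereal) \<Rightarrow> ('a \<Rightarrow> real) set" where
  "Lp_space p = {f \<in> borel_measurable lebesgue.
     \<exists>l::real. 0 < l \<and> modular p (\<lambda>x. ennreal \<bar>f x\<bar> / ennreal l) < \<infinity>}"

text \<open>Membership \<open>x \<in> ball y r\<close> forces \<open>r > 0\<close>.\<close>

definition maximal_fun :: "('a::euclidean_space \<Rightarrow> real) \<Rightarrow> 'a \<Rightarrow> ennreal" where
  "maximal_fun f x =
     Sup {(\<integral>\<^sup>+ z \<in> ball y r. ennreal \<bar>f z\<bar> \<partial>lebesgue)
            / ennreal (measure lebesgue (ball y r)) | y r. x \<in> ball y r}"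

definition frac_maximal_fun :: "real \<Rightarrow> ('a::euclidean_space \<Rightarrow> real) \<Rightarrow> 'a \<Rightarrow> ennreal" where
  "frac_maximal_fun \<alpha> f x =
     Sup {(\<integral>\<^sup>+ z \<in> ball y r. ennreal \<bar>f z\<bar> \<partial>lebesgue)
            / ennreal (measure lebesgue (ball y r) powr (1 - \<alpha> / DIM('a))) | y r. x \<in> ball y r}"

definition maximal_bounded_on :: "('a::euclidean_space \<Rightarrow> ereal) \<Rightarrow> bool" where
  "maximal_bounded_on r \<longleftrightarrow> (\<exists>C::real. 0 < C \<and>
     (\<forall>f \<in> Lp_space r.
        Lp_norm r (maximal_fun f) \<le> ennreal C * Lp_norm r (\<lambda>x. ennreal \<bar>f x\<bar>)))"

end

theory Submission
  imports Defs
begin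

text \<open>
  The weighted ingredient is a Fefferman--Stein type inequality: with \<open>\<beta> = \<alpha> / n\<close> and
  \<open>1 / q0 = 1 / p0 - \<beta>\<close>,
  \<open>\<integral> (M\<^sub>\<alpha> f)\<^bsup>q0\<^esup> h \<le> C (\<integral> |f|\<^bsup>p0\<^esup> (M h)\<^bsup>p0/q0\<^esup>)\<^bsup>q0/p0\<^esup>\<close> for \<open>p0 > 1\<close>,
  and its weak form for \<open>p0 = 1\<close>. The weak form follows from the Vitali covering lemma, the strong one
  from it by interpolation with the trivial endpoint \<open>p0 = 1 / \<beta>\<close>. Since \<open>M h\<close> itself appears on the
  right, \<open>h\<close> need not be majorized by an \<open>A\<^sub>1\<close> weight, so no Rubio de Francia iteration
  is required. Testing with \<open>h = (M\<^sub>\<alpha> f)\<^bsup>q(x) - q0\<^esup>\<close>, suitably truncated and scaled, and using the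
  boundedness of \<open>M\<close> on \<open>L\<^bsup>(q/q0)'\<^esup>\<close> yields the variable exponent bounds.
\<close>

section \<open>Weak type estimates\<close>

text \<open>The exponents fit because the constant pair \<open>p0\<close>, \<open>q0\<close> and the
  variable pair \<open>p\<close>, \<open>q\<close> have the same defect \<beta>. Put d = 1 - p0
  \<beta> = p0 / q0. The product |f|^p0 (M h)^d has to be controlled by the modular of f in
  \<open>p\<close> and that of M h in (q/q0)'. Young's inequality with exponent p(x)/p0 on the first
  factor leaves M h with the exponent d p(x) / (p(x) - p0), and the common defect makes this equal
  to q(x) / (q(x) - q0), which is (q/q0)'. Where q(x) = q0 this exponent is infinite, and the
  essential supremum part of the modular takes over. The weight shapes the interpolation: its power
  1 - p \<beta> falls from 1 - \<beta> at p = 1 to 0 at p = 1/\<beta>, so one endpoint is weighted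
  and the other is not, and f has to be cut at a height that varies with the point. The final
  comparison absorbs an integral K into itself and says nothing for infinite K. Bounded minorants of
  the maximal function with bounded support make K finite; monotone convergence removes the
  truncation afterwards.\<close>

definition superlevel :: "real \<Rightarrow> ('a::euclidean_space \<Rightarrow> real) \<Rightarrow> real \<Rightarrow> 'a set" where
  "superlevel \<theta> f t =
     {x. \<exists>y r. x \<in> ball y r \<and>
        ennreal (t * measure lebesgue (ball y r) powr \<theta>) < (\<integral>\<^sup>+ z \<in> ball y r. ennreal \<bar>f z\<bar> \<partial>lebesgue)}"

text \<open>The only property of M h that the weighted estimates use, with \<open>v\<close> in its
  place. A real-valued \<open>v\<close> cannot agree with M h where M h is infinite, so each ball is
  allowed a null set of exceptions.\<close>

definition ball_dominated :: "('a::euclidean_space \<Rightarrow> real) \<Rightarrow> ('a \<Rightarrow> real) \<Rightarrow> bool" where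
  "ball_dominated h v \<longleftrightarrow>
     (\<forall>y r. AE x in lebesgue. x \<in> ball y r \<longrightarrow>
        (\<integral>\<^sup>+ z \<in> ball y r. ennreal (h z) \<partial>lebesgue) \<le> ennreal (measure lebesgue (ball y r) * v x))"

text \<open>Each term is at most the total \<open>S\<close>, so \<open>x i powr s\<close> is at most
  \<open>x i * S powr (s - 1)\<close>. This lets the bounds for disjoint balls, each carrying the
  power 1 / \<theta>, be added without a loss depending on their number.\<close>

lemma sum_powr_le_powr_sum:
  fixes x :: "'i \<Rightarrow> real"
  assumes "finite I" and nn: "\<And>i. i \<in> I \<Longrightarrow> 0 \<le> x i" and s: "1 \<le> s"
  shows "(\<Sum>i\<in>I. x i powr s) \<le> (\<Sum>i\<in>I. x i) powr s"
proof -
  define S where "S = (\<Sum>i\<in>I. x i)"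
  have S0: "0 \<le> S" unfolding S_def by (intro sum_nonneg nn)
  have "x i powr s \<le> x i * S powr (s - 1)" if "i \<in> I" for i
  proof -
    have "x i \<le> S" unfolding S_def
      by (rule member_le_sum) (use assms that in auto)
    moreover have "x i powr s = x i * x i powr (s - 1)"
      using nn[OF that] s by (cases "x i = 0") (auto simp: powr_mult_base)
    ultimately show ?thesis
      using nn[OF that] s by (auto intro!: mult_left_mono powr_mono2)
  qed
  then have "(\<Sum>i\<in>I. x i powr s) \<le> (\<Sum>i\<in>I. x i * S powr (s - 1))"
    by (rule sum_mono)
  also have "\<dots> = S * S powr (s - 1)" by (simp add: S_def sum_distrib_right)
  also have "\<dots> = S powr s" using S0 s by (cases "S = 0") (auto simp: powr_mult_base)
  finally show ?thesis unfolding S_def .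
qed

section \<open>Balls and Lebesgue measure\<close>

lemma open_sets_lebesgue: "open S \<Longrightarrow> S \<in> sets (lebesgue :: 'a::euclidean_space measure)"
  by (rule sets_completionI_sets) (simp add: borel_open)

lemma ball_sets_lebesgue [measurable, simp]: "ball y r \<in> sets lebesgue"
  by (simp add: fmeasurableD)

lemma ball_radius_pos: "x \<in> ball y r \<Longrightarrow> 0 < r"
  by (metis ball_eq_empty empty_iff not_le)

lemma measure_ball_pos: "0 < r \<Longrightarrow> 0 < measure lebesgue (ball (y::'a::euclidean_space) r)"
  by (simp add: content_ball)

lemma measure_ball_scale:
  assumes "0 \<le> c" "0 \<le> r"
  shows "measure lebesgue (ball (y::'a::euclidean_space) (c * r))
    = c ^ DIM('a) * measure lebesgue (ball y r)"
  using assms by (simp add: content_ball power_mult_distrib)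

lemma AE_ball_witness:
  assumes "AE x in lebesgue. x \<in> ball (y::'a::euclidean_space) r \<longrightarrow> P x" and "0 < r"
  obtains x where "x \<in> ball y r" "P x"
proof -
  have "\<not> (AE x in lebesgue. x \<notin> ball y r)"
  proof
    assume "AE x in lebesgue. x \<notin> ball y r"
    then have "emeasure lebesgue (ball y r) = 0"
      by (subst (asm) AE_iff_measurable[where N="ball y r"]) auto
    with measure_ball_pos[OF assms(2), of y] show False
      by (simp add: measure_def)
  qed
  with assms(1) show thesis
    using that by (metis (mono_tags, lifting) eventually_mono)
qed

text \<open>Let H be the \<open>h\<close>-mass of the enlarged ball. Domination bounds
  \<open>v\<close> below by H / (5^n |B|) almost everywhere on the small ball B, n being the
  dimension, so the weight \<open>v powr \<theta>\<close> can be replaced there by a constant.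
  Multiplied by t |B|^\<theta>, this constant loses its dependence on |B|; that is why the weight
  carries the power \<theta>. The factor 5 anticipates the Vitali enlargement.\<close>

lemma weak_type_one_ball:
  fixes f h v :: "'a::euclidean_space \<Rightarrow> real"
  assumes [measurable]: "f \<in> borel_measurable lebesgue" "v \<in> borel_measurable lebesgue"
    and dom: "ball_dominated h v"
    and \<theta>: "0 < \<theta>" and t: "0 < t" and r: "0 < r" and a: "0 \<le> a"
    and avg: "ennreal (t * measure lebesgue (ball y r) powr \<theta>) < (\<integral>\<^sup>+ z \<in> ball y r. ennreal \<bar>f z\<bar> \<partial>lebesgue)"
    and int: "(\<integral>\<^sup>+ z \<in> ball y r. ennreal (\<bar>f z\<bar> * v z powr \<theta>) \<partial>lebesgue) \<le> ennreal a"
  shows "(\<integral>\<^sup>+ z \<in> ball y (5 * r). ennreal (h z) \<partial>lebesgue)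
    \<le> ennreal (5 ^ DIM('a) * (a / t) powr (1 / \<theta>))"
proof -
  define m where "m = measure lebesgue (ball y r)"
  define n where "n = (5::real) ^ DIM('a)"
  have m: "0 < m" unfolding m_def by (rule measure_ball_pos[OF r])
  have n: "0 < n" unfolding n_def by simp
  have m5: "measure lebesgue (ball y (5 * r)) = n * m"
    unfolding m_def n_def by (rule measure_ball_scale) (use r in auto)
  define H where "H = (\<integral>\<^sup>+ z \<in> ball y (5 * r). ennreal (h z) \<partial>lebesgue)"
  have ae5: "AE x in lebesgue. x \<in> ball y (5 * r) \<longrightarrow> H \<le> ennreal (n * m * v x)"
    using dom unfolding ball_dominated_def H_def m5[symmetric] by blast
  have ae: "AE x in lebesgue. x \<in> ball y r \<longrightarrow> H \<le> ennreal (n * m * v x)"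
    using ae5 by (rule eventually_mono) (use r in auto)
  \<comment> \<open>One point with a real bound is enough: it shows that \<open>H\<close> is finite,
    so that it can be handled as a real number \<open>k\<close>.\<close>
  obtain x0 where "H \<le> ennreal (n * m * v x0)"
    using ae r by (rule AE_ball_witness)
  then obtain k where k: "0 \<le> k" "H = ennreal k"
    by (cases H) (auto simp: top_unique)
  define w where "w = (k / (n * m)) powr \<theta>"
  have w0: "0 \<le> w" by (simp add: w_def)
  have wv: "w \<le> v x powr \<theta>" if "H \<le> ennreal (n * m * v x)" for x
  proof (cases "k = 0")
    case True then show ?thesis by (simp add: w_def)
  next
    case False
    with that k m n have "k \<le> n * m * v x"
      by (simp add: ennreal_le_iff2)
    then show ?thesis unfolding w_def
      using k m n \<theta> by (intro powr_mono2) (auto simp: field_simps)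
  qed
  have "ennreal w * ennreal (t * m powr \<theta>) \<le> ennreal w * (\<integral>\<^sup>+ z \<in> ball y r. ennreal \<bar>f z\<bar> \<partial>lebesgue)"
    using avg unfolding m_def by (intro mult_left_mono) auto
  also have "\<dots> = (\<integral>\<^sup>+ z \<in> ball y r. ennreal (w * \<bar>f z\<bar>) \<partial>lebesgue)"
    by (subst nn_integral_cmult[symmetric]) (auto intro!: nn_integral_cong simp: ennreal_mult w0 mult.assoc)
  also have "\<dots> \<le> (\<integral>\<^sup>+ z \<in> ball y r. ennreal (\<bar>f z\<bar> * v z powr \<theta>) \<partial>lebesgue)"
    using ae
    by (intro nn_integral_mono_AE, elim eventually_mono)
       (auto simp: indicator_def mult.commute[of _ "_ powr \<theta>"] intro!: ennreal_leI mult_right_mono wv)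
  also note int
  finally have "ennreal (w * (t * m powr \<theta>)) \<le> ennreal a"
    using w0 t by (simp add: ennreal_mult)
  then have "w * (t * m powr \<theta>) \<le> a" using a by (simp add: ennreal_le_iff)
  moreover have "w * m powr \<theta> = (k / n) powr \<theta>"
    unfolding w_def using k m n by (subst powr_mult[symmetric]) (auto simp: field_simps)
  ultimately have "(k / n) powr \<theta> \<le> a / t"
    using t by (simp add: field_simps)
  then have "((k / n) powr \<theta>) powr (1 / \<theta>) \<le> (a / t) powr (1 / \<theta>)"
    using \<theta> by (intro powr_mono2) auto
  then have "k / n \<le> (a / t) powr (1 / \<theta>)"
    using \<theta> k n by (simp add: powr_powr)
  then have "k \<le> n * (a / t) powr (1 / \<theta>)"
    using n by (simp add: field_simps)
  then show ?thesis
    using k unfolding H_def n_def by (simp add: ennreal_leI)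
qed

text \<open>The Vitali selection gives disjoint balls whose fivefold enlargements cover the union.
  Each enlargement is charged to the integral \<open>b i\<close> over its own small ball. By
  disjointness these integrals add up to at most \<open>a\<close>, and 1 / \<theta> \<ge> 1 keeps
  the sum of their powers below the power of their sum.\<close>

lemma weak_type_finite:
  fixes f h v :: "'a::euclidean_space \<Rightarrow> real"
  assumes [measurable]: "f \<in> borel_measurable lebesgue" "v \<in> borel_measurable lebesgue"
      "h \<in> borel_measurable lebesgue"
    and dom: "ball_dominated h v"
    and \<theta>: "0 < \<theta>" "\<theta> \<le> 1" and t: "0 < t" and a: "0 \<le> a"
    and int: "(\<integral>\<^sup>+ z. ennreal (\<bar>f z\<bar> * v z powr \<theta>) \<partial>lebesgue) \<le> ennreal a"
    and fin: "finite I" 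
    and avg: "\<And>y r. (y, r) \<in> I \<Longrightarrow> 0 < r \<and> ennreal (t * measure lebesgue (ball y r) powr \<theta>)
        < (\<integral>\<^sup>+ z \<in> ball y r. ennreal \<bar>f z\<bar> \<partial>lebesgue)"
  shows "(\<integral>\<^sup>+ z \<in> (\<Union>(y, r)\<in>I. ball y r). ennreal (h z) \<partial>lebesgue)
    \<le> ennreal (5 ^ DIM('a) * (a / t) powr (1 / \<theta>))"
proof -
  \<comment> \<open>The selection requires a common bound on the radii; the inserted 1 keeps
    \<open>Max\<close> meaningful for empty \<open>I\<close>.\<close>
  define R where "R = Max (insert 1 (snd ` I))"
  have RI: "0 < snd i \<and> snd i \<le> R" if "i \<in> I" for i
    using that avg[of "fst i" "snd i"] fin unfolding R_def by (auto intro!: Max_ge)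
  obtain C where C: "C \<subseteq> I"
     "pairwise (\<lambda>i j. disjnt (cball (fst i) (snd i)) (cball (fst j) (snd j))) C"
     "\<And>i. i \<in> I \<Longrightarrow> \<exists>j. j \<in> C \<and> \<not> disjnt (cball (fst i) (snd i)) (cball (fst j) (snd j)) \<and>
                        cball (fst i) (snd i) \<subseteq> ball (fst j) (5 * snd j)"
    by (rule Vitali_covering_lemma_cballs_balls[of I snd R fst, OF RI]) (assumption, (rule that; assumption))
  have finC: "finite C" using C(1) fin by (rule finite_subset)
  let ?B = "\<lambda>i. ball (fst i) (snd i)"
  let ?g = "\<lambda>z. ennreal (\<bar>f z\<bar> * v z powr \<theta>)"
  define A where "A i = (\<integral>\<^sup>+ z \<in> ?B i. ?g z \<partial>lebesgue)" for i
  define b where "b i = enn2real (A i)" for i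
  have "A i \<le> ennreal a" for i
  proof -
    have "A i \<le> (\<integral>\<^sup>+ z. ?g z \<partial>lebesgue)"
      unfolding A_def by (rule nn_integral_mono) (auto simp: indicator_def)
    with int show ?thesis by (rule order_trans[rotated])
  qed
  then have Ab: "A i = ennreal (b i)" for i
    unfolding b_def by (metis ennreal_enn2real ennreal_less_top order_le_less_trans)
  have b0: "0 \<le> b i" for i by (simp add: b_def)
  have disj: "disjoint_family_on ?B C"
    unfolding disjoint_family_on_def
    using C(2) unfolding pairwise_def disjnt_def by (meson ball_subset_cball disjoint_iff subsetD)
  have "ennreal (\<Sum>i\<in>C. b i) = (\<Sum>i\<in>C. A i)" using b0 by (simp add: Ab sum_ennreal)
  also have "\<dots> = (\<integral>\<^sup>+ z \<in> (\<Union>i\<in>C. ?B i). ?g z \<partial>lebesgue)"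
  proof -
    have "(\<Sum>i\<in>C. A i) = (\<integral>\<^sup>+ z. (\<Sum>i\<in>C. ?g z * indicator (?B i) z) \<partial>lebesgue)"
      unfolding A_def by (rule nn_integral_sum[symmetric]) auto
    also have "\<dots> = (\<integral>\<^sup>+ z \<in> (\<Union>i\<in>C. ?B i). ?g z \<partial>lebesgue)"
      by (simp add: indicator_UN_disjoint[OF finC disj] sum_distrib_left)
    finally show ?thesis .
  qed
  also have "\<dots> \<le> (\<integral>\<^sup>+ z. ?g z \<partial>lebesgue)"
    by (rule nn_integral_mono) (auto simp: indicator_def)
  also note int
  finally have sumb: "(\<Sum>i\<in>C. b i) \<le> a" using a by (simp add: ennreal_le_iff)
  have "(\<integral>\<^sup>+ z \<in> (\<Union>(y, r)\<in>I. ball y r). ennreal (h z) \<partial>lebesgue)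
    \<le> (\<integral>\<^sup>+ z. (\<Sum>i\<in>C. ennreal (h z) * indicator (ball (fst i) (5 * snd i)) z) \<partial>lebesgue)"
  proof (rule nn_integral_mono)
    fix z
    show "ennreal (h z) * indicator (\<Union>(y, r)\<in>I. ball y r) z
      \<le> (\<Sum>i\<in>C. ennreal (h z) * indicator (ball (fst i) (5 * snd i)) z)"
    proof (cases "z \<in> (\<Union>(y, r)\<in>I. ball y r)")
      case True
      then obtain i where i: "i \<in> I" "z \<in> ?B i" by auto
      then obtain j where j: "j \<in> C" "z \<in> ball (fst j) (5 * snd j)"
        using C(3)[OF i(1)] ball_subset_cball by blast
      have "ennreal (h z) * indicator (ball (fst j) (5 * snd j)) z
        \<le> (\<Sum>i\<in>C. ennreal (h z) * indicator (ball (fst i) (5 * snd i)) z)"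
        by (rule member_le_sum) (use finC j in auto)
      with True j show ?thesis by simp
    qed auto
  qed
  also have "\<dots> = (\<Sum>i\<in>C. (\<integral>\<^sup>+ z \<in> ball (fst i) (5 * snd i). ennreal (h z) \<partial>lebesgue))"
    by (rule nn_integral_sum) auto
  also have "\<dots> \<le> (\<Sum>i\<in>C. ennreal (5 ^ DIM('a) * (b i / t) powr (1 / \<theta>)))"
  proof (rule sum_mono)
    fix i assume "i \<in> C"
    with C(1) have "(fst i, snd i) \<in> I" by auto
    from avg[OF this] show "(\<integral>\<^sup>+ z \<in> ball (fst i) (5 * snd i). ennreal (h z) \<partial>lebesgue)
        \<le> ennreal (5 ^ DIM('a) * (b i / t) powr (1 / \<theta>))"
      using A_def[of i] unfolding Ab
      by (intro weak_type_one_ball[OF _ _ dom \<theta>(1) t]) (auto simp: b0)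
  qed
  also have "\<dots> = ennreal (\<Sum>i\<in>C. 5 ^ DIM('a) * (b i / t) powr (1 / \<theta>))"
    by (rule sum_ennreal) auto
  also have "\<dots> \<le> ennreal (5 ^ DIM('a) * (a / t) powr (1 / \<theta>))"
  proof (rule ennreal_leI)
    have "(\<Sum>i\<in>C. (b i / t) powr (1 / \<theta>)) \<le> (\<Sum>i\<in>C. b i / t) powr (1 / \<theta>)"
      using \<theta> t b0 by (intro sum_powr_le_powr_sum finC) auto
    also have "\<dots> \<le> (a / t) powr (1 / \<theta>)"
      using \<theta> t b0 sumb
      by (intro powr_mono2) (auto simp: sum_divide_distrib[symmetric] divide_right_mono intro!: divide_nonneg_pos sum_nonneg)
    finally show "(\<Sum>i\<in>C. 5 ^ DIM('a) * (b i / t) powr (1 / \<theta>)) \<le> 5 ^ DIM('a) * (a / t) powr (1 / \<theta>)"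
      by (simp add: sum_distrib_left[symmetric])
  qed
  finally show ?thesis .
qed

text \<open>The maximal operator is uncentred: a ball satisfying the condition lies in the set with
  all its points. So the set is open, hence measurable.\<close>

lemma superlevel_eq_Union:
  "superlevel \<theta> f t = \<Union>{ball y r | y r. 0 < r \<and>
      ennreal (t * measure lebesgue (ball y r) powr \<theta>) < (\<integral>\<^sup>+ z \<in> ball y r. ennreal \<bar>f z\<bar> \<partial>lebesgue)}"
  unfolding superlevel_def using ball_radius_pos by blast

lemma open_superlevel: "open (superlevel \<theta> f t)"
  unfolding superlevel_eq_Union by (rule open_Union) auto

text \<open>The radii of the balls that make up the superlevel set may be unbounded, so the Vitali
  step is applied to finite subfamilies. Lindelof gives a countable cover, and the bound is the same
  for all its finite initial segments, so it passes to the limit by continuity from below of the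
  measure with density \<open>h\<close>.\<close>

lemma weak_type:
  fixes f h v :: "'a::euclidean_space \<Rightarrow> real"
  assumes [measurable]: "f \<in> borel_measurable lebesgue" "v \<in> borel_measurable lebesgue"
      "h \<in> borel_measurable lebesgue"
    and dom: "ball_dominated h v"
    and \<theta>: "0 < \<theta>" "\<theta> \<le> 1" and t: "0 < t" and a: "0 \<le> a"
    and int: "(\<integral>\<^sup>+ z. ennreal (\<bar>f z\<bar> * v z powr \<theta>) \<partial>lebesgue) \<le> ennreal a"
  shows "(\<integral>\<^sup>+ z \<in> superlevel \<theta> f t. ennreal (h z) \<partial>lebesgue)
    \<le> ennreal (5 ^ DIM('a) * (a / t) powr (1 / \<theta>))"
proof -
  define P where "P = {(y, r). 0 < r \<and>
      ennreal (t * measure lebesgue (ball y r) powr \<theta>) < (\<integral>\<^sup>+ z \<in> ball y r. ennreal \<bar>f z\<bar> \<partial>lebesgue)}"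
  define \<F> where "\<F> = (\<lambda>(y, r). ball y r) ` P"
  have E: "superlevel \<theta> f t = \<Union>\<F>"
    unfolding superlevel_eq_Union \<F>_def P_def by (rule arg_cong[where f=Union]) auto
  obtain \<G> where G: "\<G> \<subseteq> \<F>" "countable \<G>" "\<Union>\<G> = \<Union>\<F>"
    by (rule Lindelof[of \<F>]) (auto simp: \<F>_def)
  then obtain Q where Q: "Q \<subseteq> P" "countable Q" "\<G> = (\<lambda>(y, r). ball y r) ` Q"
    unfolding \<F>_def by (metis countable_subset_image)
  have EQ: "superlevel \<theta> f t = (\<Union>(y, r)\<in>Q. ball y r)"
    using E G(3) Q(3) by simp
  show ?thesis
  proof (cases "Q = {}")
    case True
    then show ?thesis using EQ by simp
  next
    case False
    define I where "I k = from_nat_into Q ` {..<k}" for k :: nat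
    have IQ: "I k \<subseteq> Q" for k
      unfolding I_def using from_nat_into[OF False] by auto
    have UI: "(\<Union>k. I k) = Q"
      unfolding I_def using range_from_nat_into[OF False Q(2)] by (auto simp: image_iff)
    define \<nu> where "\<nu> = density lebesgue (\<lambda>z. ennreal (h z))"
    have \<nu>: "emeasure \<nu> S = (\<integral>\<^sup>+ z \<in> S. ennreal (h z) \<partial>lebesgue)" if "S \<in> sets lebesgue" for S
      unfolding \<nu>_def by (rule emeasure_density) (use that in auto)
    define S where "S k = (\<Union>(y, r)\<in>I k. ball y r)" for k
    have S: "open (S k)" for k unfolding S_def by auto
    then have [measurable]: "S k \<in> sets lebesgue" for k
      by (rule open_sets_lebesgue)
    have "superlevel \<theta> f t = (\<Union>k. S k)"
      unfolding S_def EQ UI[symmetric] by blast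
    then have "(\<integral>\<^sup>+ z \<in> superlevel \<theta> f t. ennreal (h z) \<partial>lebesgue) = emeasure \<nu> (\<Union>k. S k)"
      by (subst \<nu>) auto
    also have "\<dots> = (SUP k. emeasure \<nu> (S k))"
    proof (rule SUP_emeasure_incseq[symmetric])
      show "range S \<subseteq> sets \<nu>"
        using \<open>\<And>k. S k \<in> sets lebesgue\<close> by (auto simp: \<nu>_def)
      show "incseq S"
        unfolding incseq_def S_def I_def by (intro allI impI UN_mono image_mono) auto
    qed
    also have "\<dots> \<le> ennreal (5 ^ DIM('a) * (a / t) powr (1 / \<theta>))"
    proof (rule SUP_least)
      fix k
      have "emeasure \<nu> (S k) = (\<integral>\<^sup>+ z \<in> S k. ennreal (h z) \<partial>lebesgue)"
        by (rule \<nu>) fact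
      also have "\<dots> \<le> ennreal (5 ^ DIM('a) * (a / t) powr (1 / \<theta>))"
        unfolding S_def
        by (rule weak_type_finite[OF assms(1-3) dom \<theta> t a int])
          (use IQ[of k] Q(1) in \<open>auto simp: I_def P_def\<close>)
      finally show "emeasure \<nu> (S k) \<le> ennreal (5 ^ DIM('a) * (a / t) powr (1 / \<theta>))" .
    qed
    finally show ?thesis .
  qed
qed

section \<open>Interpolation\<close>

lemma sigma_finite_lebesgue: "sigma_finite_measure (lebesgue :: 'a::euclidean_space measure)"
proof
  let ?A = "range (\<lambda>k::nat. ball (0::'a) (real k))"
  have "\<Union>?A = UNIV"
    by (auto simp: dist_norm) (meson reals_Archimedean2)
  moreover have "\<forall>a\<in>?A. emeasure lebesgue a \<noteq> \<infinity>"
    using emeasure_lborel_ball_finite[of "0::'a"] by (auto simp: less_top)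
  ultimately show "\<exists>A. countable A \<and> A \<subseteq> sets lebesgue \<and> \<Union>A = space lebesgue
      \<and> (\<forall>a\<in>A. emeasure (lebesgue :: 'a measure) a \<noteq> \<infinity>)"
    by (intro exI[of _ ?A]) auto
qed

lemma nn_integral_powr_interval:
  assumes "-1 < e" "0 \<le> c"
  shows "(\<integral>\<^sup>+ t. ennreal (t powr e) * indicator {0<..<c} t \<partial>lborel) = ennreal (c powr (e + 1) / (e + 1))"
proof -
  have "((\<lambda>t. t powr e) has_integral (c powr (e + 1) / (e + 1))) {0..c}"
    using assms by (rule has_integral_powr_from_0)
  then have "((\<lambda>t. if t \<in> {0..c} then t powr e else 0) has_integral (c powr (e + 1) / (e + 1))) UNIV"
    by (simp only: has_integral_restrict_UNIV)
  also have "(\<lambda>t. if t \<in> {0..c} then t powr e else 0) = (\<lambda>t. indicator {0..c} t * t powr e)"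
    by (auto simp: indicator_def)
  finally have "(\<integral>\<^sup>+ t. ennreal (indicator {0..c} t * t powr e) \<partial>lborel) = ennreal (c powr (e + 1) / (e + 1))"
    by (intro nn_integral_has_integral_lborel) auto
  moreover have "AE t in lborel. ennreal (t powr e) * indicator {0<..<c} t = ennreal (indicator {0..c} t * t powr e)"
    using AE_lborel_singleton[of 0] AE_lborel_singleton[of c]
    by eventually_elim (auto simp: indicator_def)
  ultimately show ?thesis
    by (simp add: nn_integral_cong_AE)
qed

lemma layer_cake:
  fixes u h :: "'a::euclidean_space \<Rightarrow> real"
  assumes [measurable]: "u \<in> borel_measurable lebesgue" "h \<in> borel_measurable lebesgue"
    and nn: "\<And>x. 0 \<le> u x" and q: "0 < q"
  shows "(\<integral>\<^sup>+ x. ennreal (u x powr q * h x) \<partial>lebesgue)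
    = (\<integral>\<^sup>+ t \<in> {0<..}. ennreal (q * t powr (q - 1)) * (\<integral>\<^sup>+ x \<in> {x. t < u x}. ennreal (h x) \<partial>lebesgue) \<partial>lborel)"
proof -
  interpret sigma_finite_measure "lebesgue :: 'a measure" by (rule sigma_finite_lebesgue)
  interpret pair_sigma_finite "lebesgue :: 'a measure" "lborel :: real measure" ..
  let ?g = "\<lambda>x t. ennreal (q * t powr (q - 1)) * ennreal (h x) * indicator {(x, t). 0 < t \<and> t < u x} (x, t)"
  have "ennreal (u x powr q * h x) = (\<integral>\<^sup>+ t. ?g x t \<partial>lborel)" for x
  proof -
    have "(\<integral>\<^sup>+ t. ?g x t \<partial>lborel)
      = (\<integral>\<^sup>+ t. (ennreal q * ennreal (h x)) * (ennreal (t powr (q - 1)) * indicator {0<..<u x} t) \<partial>lborel)"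
      using q by (intro nn_integral_cong) (auto simp: indicator_def ennreal_mult mult_ac)
    also have "\<dots> = ennreal q * ennreal (h x) * ennreal (u x powr q / q)"
      using q nn[of x] by (subst nn_integral_cmult) (auto simp: nn_integral_powr_interval)
    also have "\<dots> = ennreal (u x powr q) * ennreal (h x)"
    proof -
      have "ennreal q * ennreal (u x powr q / q) = ennreal (u x powr q)"
        using q by (subst ennreal_mult[symmetric]) auto
      then show ?thesis by (metis mult.assoc mult.commute)
    qed
    finally show ?thesis by (simp add: ennreal_mult')
  qed
  then have "(\<integral>\<^sup>+ x. ennreal (u x powr q * h x) \<partial>lebesgue) = (\<integral>\<^sup>+ x. (\<integral>\<^sup>+ t. ?g x t \<partial>lborel) \<partial>lebesgue)"
    by simp
  also have "\<dots> = (\<integral>\<^sup>+ t. (\<integral>\<^sup>+ x. ?g x t \<partial>lebesgue) \<partial>lborel)"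
    by (rule Fubini'[symmetric]) simp
  also have "\<dots> = (\<integral>\<^sup>+ t \<in> {0<..}. ennreal (q * t powr (q - 1)) *
      (\<integral>\<^sup>+ x \<in> {x. t < u x}. ennreal (h x) \<partial>lebesgue) \<partial>lborel)"
  proof (rule nn_integral_cong)
    fix t :: real
    have "(\<integral>\<^sup>+ x. ?g x t \<partial>lebesgue) = (\<integral>\<^sup>+ x. (ennreal (q * t powr (q - 1)) * indicator {0<..} t)
        * (ennreal (h x) * indicator {x. t < u x} x) \<partial>lebesgue)"
      by (intro nn_integral_cong) (auto simp: indicator_def)
    also have "\<dots> = (ennreal (q * t powr (q - 1)) * indicator {0<..} t)
        * (\<integral>\<^sup>+ x \<in> {x. t < u x}. ennreal (h x) \<partial>lebesgue)"
      by (rule nn_integral_cmult) simp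
    finally show "(\<integral>\<^sup>+ x. ?g x t \<partial>lebesgue) = ennreal (q * t powr (q - 1)) *
        (\<integral>\<^sup>+ x \<in> {x. t < u x}. ennreal (h x) \<partial>lebesgue) * indicator {0<..} t"
      by (simp add: mult_ac)
  qed
  finally show ?thesis .
qed

text \<open>Above \<tau> the factor (y/\<tau>)^(1/\<beta> - 1) is at least 1 and raises y to
  y^(1/\<beta>); the excess 1/\<beta> - p of the exponent is then absorbed by
  \<open>y \<le> T * w powr \<beta>\<close>. Integrated over a ball with a suitable \<tau>, this
  does the work of Hoelder's inequality with exponent 1/\<beta>.\<close>

lemma low_part_pointwise:
  fixes y w T \<tau> p \<beta> :: real
  assumes "0 \<le> y" "0 \<le> w" "0 < T" "0 < \<tau>" "0 < \<beta>" "\<beta> < 1" "p * \<beta> < 1"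
    and le: "y \<le> T * w powr \<beta>"
  shows "y \<le> \<tau> + \<tau> powr (1 - 1 / \<beta>) * T powr (1 / \<beta> - p) * (y powr p * w powr (1 - p * \<beta>))"
proof (cases "y \<le> \<tau>")
  case True
  then show ?thesis using assms by (simp add: add_increasing2)
next
  case False
  then have y: "0 < y" "\<tau> < y" using assms by auto
  have w: "0 < w" using le y assms by (cases "w = 0") auto
  have "y powr (1 / \<beta> - p) \<le> (T * w powr \<beta>) powr (1 / \<beta> - p)"
    using assms y by (intro powr_mono2) (auto simp: field_simps)
  also have "\<dots> = T powr (1 / \<beta> - p) * w powr (1 - p * \<beta>)"
    using assms w by (simp add: powr_mult powr_powr algebra_simps)
  finally have 1: "y powr (1 / \<beta> - p) \<le> T powr (1 / \<beta> - p) * w powr (1 - p * \<beta>)" .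
  have "\<tau> powr (1 / \<beta> - 1) \<le> y powr (1 / \<beta> - 1)"
    using assms y by (intro powr_mono2) (auto simp: field_simps)
  then have "1 \<le> \<tau> powr (1 - 1 / \<beta>) * y powr (1 / \<beta> - 1)"
  proof -
    have "\<tau> powr (1 - 1 / \<beta>) * \<tau> powr (1 / \<beta> - 1) = 1"
      using assms by (simp add: powr_add[symmetric])
    with \<open>\<tau> powr (1 / \<beta> - 1) \<le> y powr (1 / \<beta> - 1)\<close> show ?thesis
      by (metis mult_left_mono powr_ge_zero)
  qed
  then have "y * 1 \<le> y * (\<tau> powr (1 - 1 / \<beta>) * y powr (1 / \<beta> - 1))"
    using y by (intro mult_left_mono) auto
  also have "\<dots> = \<tau> powr (1 - 1 / \<beta>) * y powr p * y powr (1 / \<beta> - p)"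
  proof -
    have "y * y powr (1 / \<beta> - 1) = y powr (1 / \<beta>)" using y by (simp add: powr_mult_base)
    moreover have "y powr p * y powr (1 / \<beta> - p) = y powr (1 / \<beta>)"
      by (simp add: powr_add[symmetric])
    ultimately show ?thesis by (simp add: mult_ac)
  qed
  also have "\<dots> \<le> \<tau> powr (1 - 1 / \<beta>) * y powr p * (T powr (1 / \<beta> - p) * w powr (1 - p * \<beta>))"
    using 1 by (intro mult_left_mono) auto
  finally show ?thesis using assms by (simp add: mult_ac)
qed

text \<open>As 1 - p \<le> 0, the lower bound on y bounds y^(1 - p) above by (T w^\<beta>)^(1 - p).
  The weight power 1 - \<beta> of the weak type estimate thereby becomes the power 1 - p \<beta> of
  the p-integral, since \<beta> (1 - p) + 1 - \<beta> = 1 - p \<beta>.\<close>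

lemma high_part_pointwise:
  fixes y w T p \<beta> :: real
  assumes "0 \<le> y" "0 \<le> w" "0 < T" "1 \<le> p" 
    and less: "T * w powr \<beta> < y"
  shows "y * w powr (1 - \<beta>) \<le> T powr (1 - p) * (y powr p * w powr (1 - p * \<beta>))"
proof (cases "w = 0")
  case False
  then have w: "0 < w" using assms by simp
  then have Tw: "0 < T * w powr \<beta>" using assms by simp
  then have y: "0 < y" using less by linarith
  have "y powr (1 - p) \<le> (T * w powr \<beta>) powr (1 - p)"
    using assms Tw by (intro powr_mono2') auto
  also have "\<dots> = T powr (1 - p) * w powr (\<beta> * (1 - p))"
    using assms w by (simp add: powr_mult powr_powr)
  finally have "y powr p * y powr (1 - p) * w powr (1 - \<beta>)
      \<le> y powr p * (T powr (1 - p) * w powr (\<beta> * (1 - p))) * w powr (1 - \<beta>)"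
    by (intro mult_right_mono mult_left_mono) auto
  moreover have "w powr (\<beta> * (1 - p)) * w powr (1 - \<beta>) = w powr (1 - p * \<beta>)"
    by (simp add: powr_add[symmetric] algebra_simps)
  moreover have "y powr p * y powr (1 - p) = y"
    using y by (simp add: powr_add[symmetric])
  ultimately show ?thesis by (simp add: mult_ac)
qed simp

text \<open>The part of \<open>f\<close> below \<open>T v\<^sup>\<beta>\<close> lies in \<open>L\<^bsup>1/\<beta>\<^esup>\<close>, at which
  exponent the fractional maximal operator is bounded into \<open>L\<^sup>\<infinity>\<close>; \<open>T\<close> is chosen so that this part
  contributes at most \<open>t / 2\<close>.\<close>

lemma superlevel_subset_high_part:
  fixes f v :: "'a::euclidean_space \<Rightarrow> real"
  assumes [measurable]: "f \<in> borel_measurable lebesgue" "v \<in> borel_measurable lebesgue"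
    and v: "\<And>x. 0 \<le> v x"
    and \<beta>: "0 < \<beta>" "\<beta> < 1" and p: "p * \<beta> < 1" and t: "0 < t"
    and T: "T = (t / 4) powr (1 / (1 - p * \<beta>))"
    and int: "(\<integral>\<^sup>+ z. ennreal (\<bar>f z\<bar> powr p * v z powr (1 - p * \<beta>)) \<partial>lebesgue) \<le> 1"
  shows "superlevel (1 - \<beta>) f t
    \<subseteq> superlevel (1 - \<beta>) (\<lambda>x. if T * v x powr \<beta> < \<bar>f x\<bar> then f x else 0) (t / 2)"
proof
  fix x assume "x \<in> superlevel (1 - \<beta>) f t"
  then obtain y r where x: "x \<in> ball y r" and
    avg: "ennreal (t * measure lebesgue (ball y r) powr (1 - \<beta>)) < (\<integral>\<^sup>+ z \<in> ball y r. ennreal \<bar>f z\<bar> \<partial>lebesgue)"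
    unfolding superlevel_def by auto
  have r: "0 < r" using x by (rule ball_radius_pos)
  define m where "m = measure lebesgue (ball y r)"
  have m: "0 < m" unfolding m_def by (rule measure_ball_pos[OF r])
  have em: "emeasure lebesgue (ball y r) = ennreal m"
    unfolding m_def by (rule emeasure_eq_ennreal_measure) (use emeasure_lborel_ball_finite[of y r] in \<open>auto simp: less_top\<close>)
  let ?f1 = "\<lambda>x. if T * v x powr \<beta> < \<bar>f x\<bar> then f x else 0"
  let ?f2 = "\<lambda>x. if T * v x powr \<beta> < \<bar>f x\<bar> then 0 else f x"
  let ?F = "\<lambda>z. \<bar>f z\<bar> powr p * v z powr (1 - p * \<beta>)"
  have T0: "0 < T" using T t by simp
  \<comment> \<open>The cut \<tau> depends on the ball: both \<tau> m and the constant
    \<open>k\<close> in front of the p-integral come out as (t/4) m^(1 - \<beta>), together half of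
    the threshold.\<close>
  define \<tau> where "\<tau> = (t / 4) * m powr (- \<beta>)"
  have \<tau>: "0 < \<tau>" using t m by (simp add: \<tau>_def)
  define k where "k = \<tau> powr (1 - 1 / \<beta>) * T powr (1 / \<beta> - p)"
  have k0: "0 \<le> k" by (simp add: k_def)
  have "T powr (1 / \<beta> - p) = (t / 4) powr (1 / \<beta>)"
  proof -
    have "1 / (1 - p * \<beta>) * (1 / \<beta> - p) = 1 / \<beta>" using \<beta> p by (simp add: field_simps)
    then show ?thesis unfolding T by (simp add: powr_powr)
  qed
  moreover have "\<tau> powr (1 - 1 / \<beta>) = (t / 4) powr (1 - 1 / \<beta>) * m powr (1 - \<beta>)"
  proof -
    have "- \<beta> * (1 - 1 / \<beta>) = 1 - \<beta>" using \<beta> by (simp add: field_simps)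
    then show ?thesis unfolding \<tau>_def using t m by (subst powr_mult) (auto simp: powr_powr)
  qed
  ultimately have "k = ((t / 4) powr (1 - 1 / \<beta>) * (t / 4) powr (1 / \<beta>)) * m powr (1 - \<beta>)"
    unfolding k_def by simp
  also have "(t / 4) powr (1 - 1 / \<beta>) * (t / 4) powr (1 / \<beta>) = t / 4"
    using t by (subst powr_add[symmetric]) simp
  finally have k: "k = t / 4 * m powr (1 - \<beta>)" .
  have \<tau>m: "\<tau> * m = t / 4 * m powr (1 - \<beta>)"
  proof -
    have "m powr (- \<beta>) * m = m powr (1 - \<beta>)"
      using m by (metis add.commute diff_conv_add_uminus mult.commute powr_mult_base less_imp_le)
    then show ?thesis by (simp add: \<tau>_def)
  qed
  have "(\<integral>\<^sup>+ z \<in> ball y r. ennreal \<bar>?f2 z\<bar> \<partial>lebesgue)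
    \<le> (\<integral>\<^sup>+ z. ennreal \<tau> * indicator (ball y r) z + ennreal k * ennreal (?F z) \<partial>lebesgue)"
  proof (rule nn_integral_mono)
    fix z
    have "\<bar>?f2 z\<bar> \<le> \<tau> + k * ?F z"
      using low_part_pointwise[of "\<bar>f z\<bar>" "v z" T \<tau> \<beta> p] v[of z] T0 \<tau> \<beta> p k0
      by (auto simp: k_def)
    then have "ennreal \<bar>?f2 z\<bar> \<le> ennreal \<tau> + ennreal k * ennreal (?F z)"
      using \<tau> k0 by (simp add: ennreal_mult[symmetric] ennreal_plus[symmetric] del: ennreal_plus)
    then show "ennreal \<bar>?f2 z\<bar> * indicator (ball y r) z
      \<le> ennreal \<tau> * indicator (ball y r) z + ennreal k * ennreal (?F z)"
      by (auto simp: indicator_def)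
  qed
  also have "\<dots> = ennreal \<tau> * ennreal m + ennreal k * (\<integral>\<^sup>+ z. ennreal (?F z) \<partial>lebesgue)"
    by (subst nn_integral_add) (auto simp: nn_integral_cmult em)
  also have "\<dots> \<le> ennreal \<tau> * ennreal m + ennreal k * 1"
    using int by (intro add_mono mult_left_mono) auto
  also have "\<dots> = ennreal (t / 2 * m powr (1 - \<beta>))"
    using \<tau> m k0 k \<tau>m by (simp add: ennreal_mult[symmetric] ennreal_plus[symmetric] del: ennreal_plus)
  finally have low: "(\<integral>\<^sup>+ z \<in> ball y r. ennreal \<bar>?f2 z\<bar> \<partial>lebesgue) \<le> ennreal (t / 2 * m powr (1 - \<beta>))" .
  have split: "(\<integral>\<^sup>+ z \<in> ball y r. ennreal \<bar>f z\<bar> \<partial>lebesgue)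
    = (\<integral>\<^sup>+ z \<in> ball y r. ennreal \<bar>?f1 z\<bar> \<partial>lebesgue) + (\<integral>\<^sup>+ z \<in> ball y r. ennreal \<bar>?f2 z\<bar> \<partial>lebesgue)"
  proof -
    have "(\<lambda>z. ennreal \<bar>?f1 z\<bar> * indicator (ball y r) z) \<in> borel_measurable lebesgue"
      "(\<lambda>z. ennreal \<bar>?f2 z\<bar> * indicator (ball y r) z) \<in> borel_measurable lebesgue"
      by measurable
    from nn_integral_add[OF this, symmetric] show ?thesis
      by (auto intro!: nn_integral_cong simp: indicator_def)
  qed
  have "ennreal (t / 2 * m powr (1 - \<beta>)) < (\<integral>\<^sup>+ z \<in> ball y r. ennreal \<bar>?f1 z\<bar> \<partial>lebesgue)"
  proof (rule ccontr)
    assume "\<not> ?thesis"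
    then have "(\<integral>\<^sup>+ z \<in> ball y r. ennreal \<bar>f z\<bar> \<partial>lebesgue)
      \<le> ennreal (t / 2 * m powr (1 - \<beta>)) + ennreal (t / 2 * m powr (1 - \<beta>))"
      unfolding split using low by (intro add_mono) auto
    also have "\<dots> = ennreal (t * m powr (1 - \<beta>))"
      using t by (simp add: ennreal_plus[symmetric] del: ennreal_plus)
    finally show False using avg unfolding m_def by simp
  qed
  with x show "x \<in> superlevel (1 - \<beta>) ?f1 (t / 2)"
    unfolding superlevel_def m_def by blast
qed

text \<open>The cut-off condition solved for \<open>t\<close>. After the exchange of integrals it
  gives the upper end of the integration over \<open>t\<close> at a fixed point.\<close>

lemma high_part_level:
  fixes y w t p \<beta> :: real
  assumes "0 < w" "0 \<le> y" "0 < t" "p * \<beta> < 1"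
    and less: "(t / 4) powr (1 / (1 - p * \<beta>)) * w powr \<beta> < y"
  shows "t < 4 * (y * w powr (- \<beta>)) powr (1 - p * \<beta>)"
proof -
  have "(t / 4) powr (1 / (1 - p * \<beta>)) < y * w powr (- \<beta>)"
    using less assms by (simp add: powr_minus field_simps)
  then have "((t / 4) powr (1 / (1 - p * \<beta>))) powr (1 - p * \<beta>) < (y * w powr (- \<beta>)) powr (1 - p * \<beta>)"
    using assms by (intro powr_less_mono2) auto
  then show ?thesis using assms by (simp add: powr_powr)
qed

text \<open>The Fefferman-Stein inequality in normalized form. \<open>F\<close> stands for the
  maximal function or for a multiple of the indicator of one of its level sets, so that the strong
  and the weak case share the passage to variable exponents. As \<open>F\<close> may be infinite, it
  enters through real minorants \<open>u\<close>. The normalization to 1 is arranged later by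
  scaling \<open>h\<close> and \<open>v\<close>.\<close>

definition weighted_bound ::
    "real \<Rightarrow> real \<Rightarrow> real \<Rightarrow> ('a::euclidean_space \<Rightarrow> real) \<Rightarrow> ('a \<Rightarrow> ennreal) \<Rightarrow> bool" where
  "weighted_bound p0 \<beta> C f F \<longleftrightarrow>
     (\<forall>h v u. h \<in> borel_measurable lebesgue \<longrightarrow> v \<in> borel_measurable lebesgue \<longrightarrow>
        u \<in> borel_measurable lebesgue \<longrightarrow> (\<forall>x. 0 \<le> h x) \<longrightarrow> (\<forall>x. 0 \<le> v x) \<longrightarrow> (\<forall>x. 0 \<le> u x) \<longrightarrow>
        (\<forall>x. ennreal (u x) \<le> F x) \<longrightarrow> ball_dominated h v \<longrightarrow>
        (\<integral>\<^sup>+ z. ennreal (\<bar>f z\<bar> powr p0 * v z powr (1 - p0 * \<beta>)) \<partial>lebesgue) \<le> 1 \<longrightarrow>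
        (\<integral>\<^sup>+ z. ennreal (u z powr (p0 / (1 - p0 * \<beta>)) * h z) \<partial>lebesgue) \<le> ennreal C)"

text \<open>Off-diagonal Marcinkiewicz interpolation between the weak type \<open>(1, 1 / (1 - \<beta>))\<close> bound and
  the trivial \<open>(1 / \<beta>, \<infinity>)\<close> bound.\<close>

lemma strong_type:
  fixes \<beta> p :: real
  assumes \<beta>: "0 < \<beta>" "\<beta> < 1" and p: "1 < p" "p * \<beta> < 1"
  obtains C where "0 < C"
    "\<And>(f :: 'a::euclidean_space \<Rightarrow> real) F.
       f \<in> borel_measurable lebesgue \<Longrightarrow>
       (\<And>x t. 0 < t \<Longrightarrow> ennreal t < F x \<Longrightarrow> x \<in> superlevel (1 - \<beta>) f t) \<Longrightarrow>
       weighted_bound p \<beta> C f F"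
proof -
  define d where "d = 1 - p * \<beta>"
  define q where "q = p / d"
  define s where "s = 1 / (1 - \<beta>)"
  \<comment> \<open>The power of \<open>t\<close> that remains when the level estimate is inserted
    into the layer cake formula; e + 1 = (p - 1) / d > 0 makes it integrable at 0.\<close>
  define e where "e = (p - 1) / d - 1"
  have d: "0 < d" using p by (simp add: d_def)
  have q: "0 < q" using p d by (simp add: q_def)
  have s: "1 < s" using \<beta> by (simp add: s_def)
  have e: "-1 < e" using p d by (simp add: e_def)
  define T where "T t = (t / 4) powr (1 / d)" for t :: real
  define K where "K = q * 5 ^ DIM('a) * 2 powr s * 4 powr - ((1 - p) * (s - 1) / d)"
  have K: "0 < K" using q by (simp add: K_def)
  define C where "C = K * 4 powr (e + 1) / (e + 1)"
  have C: "0 < C" using K e by (simp add: C_def)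
  have KT: "q * t powr (q - 1) * (5 ^ DIM('a) * ((T t powr (1 - p)) powr (s - 1) * (2 / t) powr s)) = K * t powr e"
    if t: "0 < t" for t
  proof -
    have "(T t powr (1 - p)) powr (s - 1) = t powr ((1 - p) * (s - 1) / d) * 4 powr - ((1 - p) * (s - 1) / d)"
      unfolding T_def using t by (simp add: powr_powr powr_divide powr_minus_divide)
    moreover have "(2 / t) powr s = 2 powr s * t powr (- s)"
      using t by (simp add: powr_divide powr_minus_divide)
    moreover have "t powr (q - 1) * t powr ((1 - p) * (s - 1) / d) * t powr (- s) = t powr e"
    proof -
      have "s * \<beta> = s - 1" using \<beta> by (simp add: s_def field_simps)
      then have "s * d = s - p * (s - 1)" by (metis d_def mult.left_commute mult.right_neutral right_diff_distrib)
      then have "p + (1 - p) * (s - 1) - (p - 1) = s * d" by (simp add: algebra_simps)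
      then have "p / d + (1 - p) * (s - 1) / d - (p - 1) / d = s"
        using d by (simp add: diff_divide_distrib[symmetric] add_divide_distrib[symmetric])
      then have "(q - 1) + (1 - p) * (s - 1) / d + (- s) = e"
        unfolding q_def e_def by linarith
      then show ?thesis by (simp add: powr_add[symmetric])
    qed
    ultimately show ?thesis unfolding K_def by (simp add: mult_ac) 
  qed
  show thesis
  proof (rule that[OF C])
    fix f :: "'a \<Rightarrow> real" and F :: "'a \<Rightarrow> ennreal"
    assume f [measurable]: "f \<in> borel_measurable lebesgue"
      and F: "\<And>x t. 0 < t \<Longrightarrow> ennreal t < F x \<Longrightarrow> x \<in> superlevel (1 - \<beta>) f t"
    show "weighted_bound p \<beta> C f F"
      unfolding weighted_bound_def
    proof (intro allI impI)
      fix h v u :: "'a \<Rightarrow> real"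
      assume [measurable]: "h \<in> borel_measurable lebesgue" "v \<in> borel_measurable lebesgue"
         "u \<in> borel_measurable lebesgue"
        and v: "\<forall>x. 0 \<le> v x" and u: "\<forall>x. 0 \<le> u x" and uF: "\<forall>x. ennreal (u x) \<le> F x"
        and dom: "ball_dominated h v"
        and int: "(\<integral>\<^sup>+ z. ennreal (\<bar>f z\<bar> powr p * v z powr (1 - p * \<beta>)) \<partial>lebesgue) \<le> 1"
      note meas = f \<open>v \<in> borel_measurable lebesgue\<close> \<open>h \<in> borel_measurable lebesgue\<close>
        \<open>u \<in> borel_measurable lebesgue\<close>
      note v = v[rule_format] and u = u[rule_format]
      have sup: "x \<in> superlevel (1 - \<beta>) f t" if "0 < t" "t < u x" for x t
        using F[of t x] that uF[rule_format, of x] u[of x]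
        by (meson ennreal_lessI order_less_le_trans order.strict_trans)
      interpret sigma_finite_measure "lebesgue :: 'a measure" by (rule sigma_finite_lebesgue)
      interpret pair_sigma_finite "lebesgue :: 'a measure" "lborel :: real measure" ..
      define f1 where "f1 t x = (if T t * v x powr \<beta> < \<bar>f x\<bar> then f x else 0)" for t x
      define \<Phi> where "\<Phi> t = (\<integral>\<^sup>+ z. ennreal (\<bar>f1 t z\<bar> * v z powr (1 - \<beta>)) \<partial>lebesgue)" for t
      have [measurable]: "f1 t \<in> borel_measurable lebesgue" for t
        unfolding f1_def by measurable
      have level: "(\<integral>\<^sup>+ x \<in> {x. t < u x}. ennreal (h x) \<partial>lebesgue)
        \<le> ennreal (5 ^ DIM('a) * ((T t powr (1 - p)) powr (s - 1) * (2 / t) powr s)) * \<Phi> t" if t: "0 < t" for t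
      proof -
        have T0: "0 < T t" using t by (simp add: T_def)
        have "\<Phi> t \<le> (\<integral>\<^sup>+ z. ennreal (T t powr (1 - p)) * ennreal (\<bar>f z\<bar> powr p * v z powr (1 - p * \<beta>)) \<partial>lebesgue)"
          unfolding \<Phi>_def
        proof (rule nn_integral_mono)
          fix z
          have "\<bar>f1 t z\<bar> * v z powr (1 - \<beta>) \<le> T t powr (1 - p) * (\<bar>f z\<bar> powr p * v z powr (1 - p * \<beta>))"
            using high_part_pointwise[of "\<bar>f z\<bar>" "v z" "T t" p \<beta>] v[of z] T0 p
            by (auto simp: f1_def)
          then show "ennreal (\<bar>f1 t z\<bar> * v z powr (1 - \<beta>))
              \<le> ennreal (T t powr (1 - p)) * ennreal (\<bar>f z\<bar> powr p * v z powr (1 - p * \<beta>))"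
            by (simp add: ennreal_mult[symmetric] ennreal_leI)
        qed
        also have "\<dots> = ennreal (T t powr (1 - p)) * (\<integral>\<^sup>+ z. ennreal (\<bar>f z\<bar> powr p * v z powr (1 - p * \<beta>)) \<partial>lebesgue)"
          by (rule nn_integral_cmult) measurable
        also have "\<dots> \<le> ennreal (T t powr (1 - p))"
          using mult_left_mono[OF int, of "ennreal (T t powr (1 - p))"] by simp
        finally have \<Phi>T: "\<Phi> t \<le> ennreal (T t powr (1 - p))" .
        then obtain a where a: "0 \<le> a" "\<Phi> t = ennreal a"
          by (cases "\<Phi> t") (auto simp: top_unique)
        have aT: "a \<le> T t powr (1 - p)" using \<Phi>T a by (simp add: ennreal_le_iff)
        have "{x. t < u x} \<subseteq> superlevel (1 - \<beta>) (f1 t) (t / 2)"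
        proof
          fix x assume "x \<in> {x. t < u x}"
          then have "x \<in> superlevel (1 - \<beta>) f t" using sup t by auto
          also have "superlevel (1 - \<beta>) f t \<subseteq> superlevel (1 - \<beta>) (f1 t) (t / 2)"
            unfolding f1_def
            by (rule superlevel_subset_high_part[OF meas(1,2) v \<beta> p(2) t _ int]) (simp add: T_def d_def)
          finally show "x \<in> superlevel (1 - \<beta>) (f1 t) (t / 2)" .
        qed
        then have "(\<integral>\<^sup>+ x \<in> {x. t < u x}. ennreal (h x) \<partial>lebesgue)
          \<le> (\<integral>\<^sup>+ x \<in> superlevel (1 - \<beta>) (f1 t) (t / 2). ennreal (h x) \<partial>lebesgue)"
          by (intro nn_integral_mono) (auto simp: indicator_def)
        also have "\<dots> \<le> ennreal (5 ^ DIM('a) * (a / (t / 2)) powr (1 / (1 - \<beta>)))"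
          by (rule weak_type[OF _ meas(2,3) dom]) (use \<beta> t a \<Phi>_def[of t] in auto)
        also have "\<dots> \<le> ennreal (5 ^ DIM('a) * ((T t powr (1 - p)) powr (s - 1) * (2 / t) powr s) * a)"
        proof (rule ennreal_leI)
          have "(a / (t / 2)) powr s = a powr s * (2 / t) powr s"
            using a t by (subst powr_mult[symmetric]) auto
          \<comment> \<open>One factor \<open>a\<close> is kept as an integral, and the remaining
            power s - 1 is bounded through the normalization. The estimate becomes linear in
            \<open>\<Phi> t\<close>, which allows the exchange of integrals.\<close>
          also have "a powr s = a * a powr (s - 1)"
            using a s by (cases "a = 0") (auto simp: powr_mult_base)
          also have "\<dots> \<le> a * (T t powr (1 - p)) powr (s - 1)"
            using a aT s by (intro mult_left_mono powr_mono2) auto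
          finally show "5 ^ DIM('a) * (a / (t / 2)) powr (1 / (1 - \<beta>))
              \<le> 5 ^ DIM('a) * ((T t powr (1 - p)) powr (s - 1) * (2 / t) powr s) * a"
            by (simp add: s_def mult_ac mult_right_mono)
        qed
        finally show ?thesis using a by (simp add: ennreal_mult)
      qed
      have "(\<integral>\<^sup>+ z. ennreal (u z powr q * h z) \<partial>lebesgue)
        = (\<integral>\<^sup>+ t \<in> {0<..}. ennreal (q * t powr (q - 1)) * (\<integral>\<^sup>+ x \<in> {x. t < u x}. ennreal (h x) \<partial>lebesgue) \<partial>lborel)"
        by (rule layer_cake[OF meas(4,3) u q])
      also have "\<dots> \<le> (\<integral>\<^sup>+ t \<in> {0<..}. ennreal (K * t powr e) * \<Phi> t \<partial>lborel)"
      proof (rule nn_integral_mono)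
        fix t :: real
        show "ennreal (q * t powr (q - 1)) * (\<integral>\<^sup>+ x \<in> {x. t < u x}. ennreal (h x) \<partial>lebesgue) * indicator {0<..} t
          \<le> ennreal (K * t powr e) * \<Phi> t * indicator {0<..} t"
        proof (cases "0 < t")
          case True
          have "ennreal (q * t powr (q - 1)) * (\<integral>\<^sup>+ x \<in> {x. t < u x}. ennreal (h x) \<partial>lebesgue)
            \<le> ennreal (q * t powr (q - 1)) * (ennreal (5 ^ DIM('a) * ((T t powr (1 - p)) powr (s - 1) * (2 / t) powr s)) * \<Phi> t)"
            by (rule mult_left_mono[OF level[OF True]]) simp
          also have "\<dots> = ennreal (K * t powr e) * \<Phi> t"
            unfolding KT[OF True, symmetric] using q by (simp add: ennreal_mult mult.assoc)
          finally show ?thesis using True by simp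
        qed simp
      qed
      also have "\<dots> = (\<integral>\<^sup>+ t. (\<integral>\<^sup>+ x. ennreal (K * t powr e) * ennreal (\<bar>f x\<bar> * v x powr (1 - \<beta>))
          * indicator {(x, t). 0 < t \<and> T t * v x powr \<beta> < \<bar>f x\<bar>} (x, t) \<partial>lebesgue) \<partial>lborel)"
      proof (rule nn_integral_cong)
        fix t :: real
        have "ennreal (K * t powr e) * \<Phi> t * indicator {0<..} t
          = (\<integral>\<^sup>+ x. (ennreal (K * t powr e) * indicator {0<..} t) * ennreal (\<bar>f1 t x\<bar> * v x powr (1 - \<beta>)) \<partial>lebesgue)"
          unfolding \<Phi>_def by (subst nn_integral_cmult) (auto simp: mult_ac)
        also have "\<dots> = (\<integral>\<^sup>+ x. ennreal (K * t powr e) * ennreal (\<bar>f x\<bar> * v x powr (1 - \<beta>))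
          * indicator {(x, t). 0 < t \<and> T t * v x powr \<beta> < \<bar>f x\<bar>} (x, t) \<partial>lebesgue)"
          by (intro nn_integral_cong) (auto simp: f1_def indicator_def)
        finally show "ennreal (K * t powr e) * \<Phi> t * indicator {0<..} t = \<dots>" .
      qed
      also have "\<dots> = (\<integral>\<^sup>+ x. (\<integral>\<^sup>+ t. ennreal (K * t powr e) * ennreal (\<bar>f x\<bar> * v x powr (1 - \<beta>))
          * indicator {(x, t). 0 < t \<and> T t * v x powr \<beta> < \<bar>f x\<bar>} (x, t) \<partial>lborel) \<partial>lebesgue)"
        unfolding T_def by (rule Fubini') measurable
      also have "\<dots> \<le> (\<integral>\<^sup>+ x. ennreal C * ennreal (\<bar>f x\<bar> powr p * v x powr (1 - p * \<beta>)) \<partial>lebesgue)"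
      proof (rule nn_integral_mono)
        fix x
        let ?L = "4 * (\<bar>f x\<bar> * v x powr (- \<beta>)) powr d"
        show "(\<integral>\<^sup>+ t. ennreal (K * t powr e) * ennreal (\<bar>f x\<bar> * v x powr (1 - \<beta>))
          * indicator {(x, t). 0 < t \<and> T t * v x powr \<beta> < \<bar>f x\<bar>} (x, t) \<partial>lborel)
          \<le> ennreal C * ennreal (\<bar>f x\<bar> powr p * v x powr (1 - p * \<beta>))"
        \<comment> \<open>Solving for the upper limit \<open>?L\<close> takes a negative power of
          \<open>v x\<close>; where \<open>v x\<close> or \<open>f x\<close> vanishes, the integrand
          is zero.\<close>
        proof (cases "v x = 0 \<or> f x = 0")
          case False
          then have vx: "0 < v x" "0 < \<bar>f x\<bar>" using v[of x] by auto
          have "(\<integral>\<^sup>+ t. ennreal (K * t powr e) * ennreal (\<bar>f x\<bar> * v x powr (1 - \<beta>))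
              * indicator {(x, t). 0 < t \<and> T t * v x powr \<beta> < \<bar>f x\<bar>} (x, t) \<partial>lborel)
            \<le> (\<integral>\<^sup>+ t. (ennreal K * ennreal (\<bar>f x\<bar> * v x powr (1 - \<beta>))) * (ennreal (t powr e) * indicator {0<..<?L} t) \<partial>lborel)"
            using high_part_level[of "v x" "\<bar>f x\<bar>" _ p \<beta>] vx p K
            by (intro nn_integral_mono) (auto simp: indicator_def T_def d_def ennreal_mult mult_ac)
          also have "\<dots> = ennreal K * ennreal (\<bar>f x\<bar> * v x powr (1 - \<beta>)) * ennreal (?L powr (e + 1) / (e + 1))"
            using e by (subst nn_integral_cmult) (auto simp: nn_integral_powr_interval)
          also have "\<dots> = ennreal (C * (\<bar>f x\<bar> powr p * v x powr (1 - p * \<beta>)))"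
          proof -
            have "d * (e + 1) = p - 1" using d by (simp add: e_def)
            then have "?L powr (e + 1) = 4 powr (e + 1) * (\<bar>f x\<bar> powr (p - 1) * v x powr (- \<beta> * (p - 1)))"
              using vx by (simp add: powr_mult powr_powr mult.assoc)
            moreover have "\<bar>f x\<bar> * \<bar>f x\<bar> powr (p - 1) = \<bar>f x\<bar> powr p"
              using vx by (simp add: powr_mult_base)
            moreover have "v x powr (1 - \<beta>) * v x powr (- \<beta> * (p - 1)) = v x powr (1 - p * \<beta>)"
              by (simp add: powr_add[symmetric] algebra_simps)
            ultimately have "K * (\<bar>f x\<bar> * v x powr (1 - \<beta>)) * (?L powr (e + 1) / (e + 1))
                = C * (\<bar>f x\<bar> powr p * v x powr (1 - p * \<beta>))"
              unfolding C_def by (simp add: mult_ac) 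
            then show ?thesis using K e by (simp add: ennreal_mult[symmetric])
          qed
          finally show ?thesis using C by (simp add: ennreal_mult)
        qed (auto)
      qed
      also have "\<dots> = ennreal C * (\<integral>\<^sup>+ x. ennreal (\<bar>f x\<bar> powr p * v x powr (1 - p * \<beta>)) \<partial>lebesgue)"
        by (rule nn_integral_cmult) measurable
      also have "\<dots> \<le> ennreal C"
        using mult_left_mono[OF int, of "ennreal C"] by simp
      finally show "(\<integral>\<^sup>+ z. ennreal (u z powr (p / (1 - p * \<beta>)) * h z) \<partial>lebesgue) \<le> ennreal C"
        by (simp add: q_def d_def)
    qed
  qed
qed

text \<open>With s = 1/(1 - \<beta>), a function below \<open>t\<close> times the indicator of the
  superlevel set contributes at most t^s times the \<open>h\<close>-mass of that set, and the weak
  type estimate gives this mass a factor t^(-s). The powers cancel, so one constant serves every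
  level.\<close>

lemma weak_type_endpoint:
  fixes f :: "'a::euclidean_space \<Rightarrow> real"
  assumes f [measurable]: "f \<in> borel_measurable lebesgue"
    and \<beta>: "0 < \<beta>" "\<beta> < 1" and t: "0 < t"
  shows "weighted_bound 1 \<beta> (5 ^ DIM('a)) f (\<lambda>x. ennreal t * indicator (superlevel (1 - \<beta>) f t) x)"
  unfolding weighted_bound_def
proof (intro allI impI)
  fix h v u :: "'a \<Rightarrow> real"
  assume [measurable]: "h \<in> borel_measurable lebesgue" "v \<in> borel_measurable lebesgue"
     "u \<in> borel_measurable lebesgue"
    and h: "\<forall>x. 0 \<le> h x" and v: "\<forall>x. 0 \<le> v x" and u0: "\<forall>x. 0 \<le> u x"
    and uF: "\<forall>x. ennreal (u x) \<le> ennreal t * indicator (superlevel (1 - \<beta>) f t) x"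
    and dom: "ball_dominated h v"
    and int: "(\<integral>\<^sup>+ z. ennreal (\<bar>f z\<bar> powr 1 * v z powr (1 - 1 * \<beta>)) \<partial>lebesgue) \<le> 1"
  note h = h[rule_format]
  have u: "0 \<le> u x" "u x \<le> t * indicator (superlevel (1 - \<beta>) f t) x" for x
  proof -
    have "ennreal (u x) \<le> ennreal (t * indicator (superlevel (1 - \<beta>) f t) x)"
      using uF[rule_format, of x] t by (auto simp: indicator_def ennreal_eq_0_iff)
    then show "u x \<le> t * indicator (superlevel (1 - \<beta>) f t) x"
      by (rule ennreal_le_iff[THEN iffD1, rotated]) (use t in simp)
  qed (use u0 in auto)
  let ?s = "1 / (1 - \<beta>)"
  have [measurable]: "superlevel (1 - \<beta>) f t \<in> sets lebesgue"
    by (intro open_sets_lebesgue open_superlevel)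
  have "(\<integral>\<^sup>+ z. ennreal (u z powr ?s * h z) \<partial>lebesgue)
    \<le> (\<integral>\<^sup>+ z. ennreal (t powr ?s) * (ennreal (h z) * indicator (superlevel (1 - \<beta>) f t) z) \<partial>lebesgue)"
  proof (rule nn_integral_mono)
    fix z
    show "ennreal (u z powr ?s * h z) \<le> ennreal (t powr ?s) * (ennreal (h z) * indicator (superlevel (1 - \<beta>) f t) z)"
    proof (cases "z \<in> superlevel (1 - \<beta>) f t")
      case True
      then have "u z powr ?s \<le> t powr ?s" using u[of z] \<beta> by (intro powr_mono2) auto
      then have "u z powr ?s * h z \<le> t powr ?s * h z" using h by (intro mult_right_mono)
      then show ?thesis using True h by (simp add: ennreal_mult[symmetric] ennreal_leI)
    next
      case False
      then have "u z = 0" using u[of z] by simp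
      then show ?thesis by simp
    qed
  qed
  also have "\<dots> = ennreal (t powr ?s) * (\<integral>\<^sup>+ z \<in> superlevel (1 - \<beta>) f t. ennreal (h z) \<partial>lebesgue)"
    by (rule nn_integral_cmult) measurable
  also have "\<dots> \<le> ennreal (t powr ?s) * ennreal (5 ^ DIM('a) * (1 / t) powr ?s)"
    by (intro mult_left_mono weak_type[OF f _ _ dom]) (use \<beta> t int in auto)
  also have "\<dots> = ennreal (5 ^ DIM('a))"
  proof -
    have "t powr ?s * (1 / t) powr ?s = 1"
      using t by (subst powr_mult[symmetric]) auto
    then show ?thesis by (simp add: ennreal_mult[symmetric] mult.left_commute)
  qed
  finally show "(\<integral>\<^sup>+ z. ennreal (u z powr (1 / (1 - 1 * \<beta>)) * h z) \<partial>lebesgue) \<le> ennreal (5 ^ DIM('a))"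
    by simp
qed

section \<open>Maximal functions and conjugate exponents\<close>

text \<open>A supremum over the open balls containing the point is lower semicontinuous, whatever
  value \<Phi> assigns to a ball.\<close>

lemma borel_measurable_Sup_balls:
  fixes \<Phi> :: "'a::euclidean_space \<Rightarrow> real \<Rightarrow> ennreal"
  shows "(\<lambda>x. Sup {\<Phi> y r | y r. x \<in> ball y r}) \<in> borel_measurable lebesgue"
proof (rule borel_measurableI_greater)
  fix c
  have "{x \<in> space lebesgue. c < Sup {\<Phi> y r | y r. x \<in> ball y r}} = \<Union>{ball y r | y r. c < \<Phi> y r}"
    by (auto simp: less_Sup_iff simp del: mem_ball; blast)
  moreover have "open (\<Union>{ball y r | y r. c < \<Phi> y r})" by auto
  ultimately show "{x \<in> space lebesgue. c < Sup {\<Phi> y r | y r. x \<in> ball y r}} \<in> sets lebesgue"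
    by (simp add: open_sets_lebesgue)
qed

lemma borel_measurable_maximal_fun [measurable]: "maximal_fun f \<in> borel_measurable lebesgue"
  unfolding maximal_fun_def[abs_def] by (rule borel_measurable_Sup_balls)

lemma borel_measurable_frac_maximal_fun [measurable]: "frac_maximal_fun \<alpha> f \<in> borel_measurable lebesgue"
  unfolding frac_maximal_fun_def[abs_def] by (rule borel_measurable_Sup_balls)

text \<open>Every ball containing x competes in the supremum at x. Where that supremum is infinite,
  \<open>enn2real\<close> returns 0 and the inequality can fail; the finiteness assumption confines
  this to a null set.\<close>

lemma ball_dominated_maximal_fun:
  fixes h :: "'a::euclidean_space \<Rightarrow> real"
  assumes h: "\<And>x. 0 \<le> h x" and fin: "AE x in lebesgue. maximal_fun h x \<noteq> \<infinity>"
  shows "ball_dominated h (\<lambda>x. enn2real (maximal_fun h x))"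
  unfolding ball_dominated_def
proof (intro allI)
  fix y :: 'a and r
  show "AE x in lebesgue. x \<in> ball y r \<longrightarrow> (\<integral>\<^sup>+ z \<in> ball y r. ennreal (h z) \<partial>lebesgue)
    \<le> ennreal (measure lebesgue (ball y r) * enn2real (maximal_fun h x))"
    using fin
  proof (rule eventually_mono, intro impI)
    fix x assume fx: "maximal_fun h x \<noteq> \<infinity>" and x: "x \<in> ball y r"
    define m where "m = measure lebesgue (ball y r)"
    have m: "0 < m" unfolding m_def by (rule measure_ball_pos[OF ball_radius_pos[OF x]])
    have "(\<integral>\<^sup>+ z \<in> ball y r. ennreal (h z) \<partial>lebesgue) / ennreal m \<le> maximal_fun h x"
      unfolding maximal_fun_def m_def using x h by (intro Sup_upper) auto
    then have "(\<integral>\<^sup>+ z \<in> ball y r. ennreal (h z) \<partial>lebesgue) / ennreal m * ennreal m \<le> maximal_fun h x * ennreal m"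
      by (rule mult_right_mono) simp
    moreover have "(\<integral>\<^sup>+ z \<in> ball y r. ennreal (h z) \<partial>lebesgue) / ennreal m * ennreal m
        = (\<integral>\<^sup>+ z \<in> ball y r. ennreal (h z) \<partial>lebesgue)"
      using m by (simp add: ennreal_divide_times ennreal_divide_self mult_divide_eq_ennreal)
    moreover have "maximal_fun h x = ennreal (enn2real (maximal_fun h x))"
      using fx by (simp add: less_top)
    ultimately show "(\<integral>\<^sup>+ z \<in> ball y r. ennreal (h z) \<partial>lebesgue)
        \<le> ennreal (measure lebesgue (ball y r) * enn2real (maximal_fun h x))"
      using m unfolding m_def by (metis enn2real_nonneg ennreal_mult mult.commute measure_nonneg)
  qed
qed

lemma ball_dominated_divide:
  fixes h v :: "'a::euclidean_space \<Rightarrow> real"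
  assumes [measurable]: "h \<in> borel_measurable lebesgue" and dom: "ball_dominated h v" and c: "0 < c"
  shows "ball_dominated (\<lambda>x. h x / c) (\<lambda>x. v x / c)"
  unfolding ball_dominated_def
proof (intro allI)
  fix y :: 'a and r
  have "(\<integral>\<^sup>+ z \<in> ball y r. ennreal (h z / c) \<partial>lebesgue)
    = (\<integral>\<^sup>+ z. ennreal (1 / c) * (ennreal (h z) * indicator (ball y r) z) \<partial>lebesgue)"
    using c by (intro nn_integral_cong) (auto simp: indicator_def ennreal_mult'[symmetric])
  also have "\<dots> = ennreal (1 / c) * (\<integral>\<^sup>+ z \<in> ball y r. ennreal (h z) \<partial>lebesgue)"
    by (rule nn_integral_cmult) measurable
  finally have eq: "(\<integral>\<^sup>+ z \<in> ball y r. ennreal (h z / c) \<partial>lebesgue) = \<dots>" .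
  show "AE x in lebesgue. x \<in> ball y r \<longrightarrow> (\<integral>\<^sup>+ z \<in> ball y r. ennreal (h z / c) \<partial>lebesgue)
    \<le> ennreal (measure lebesgue (ball y r) * (v x / c))"
    using dom[unfolded ball_dominated_def, rule_format, of y r]
  proof (rule eventually_mono, intro impI)
    fix x assume "x \<in> ball y r \<longrightarrow> (\<integral>\<^sup>+ z \<in> ball y r. ennreal (h z) \<partial>lebesgue)
        \<le> ennreal (measure lebesgue (ball y r) * v x)" and "x \<in> ball y r"
    then have "ennreal (1 / c) * (\<integral>\<^sup>+ z \<in> ball y r. ennreal (h z) \<partial>lebesgue)
      \<le> ennreal (1 / c) * ennreal (measure lebesgue (ball y r) * v x)"
      by (intro mult_left_mono) auto
    also have "\<dots> = ennreal (measure lebesgue (ball y r) * (v x / c))"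
      using c by (simp add: ennreal_mult'[symmetric])
    finally show "(\<integral>\<^sup>+ z \<in> ball y r. ennreal (h z / c) \<partial>lebesgue)
        \<le> ennreal (measure lebesgue (ball y r) * (v x / c))"
      unfolding eq .
  qed
qed

section \<open>Powers and the arithmetic of conjugate exponents\<close>

lemma ennreal_powr_ennreal: "0 \<le> a \<Longrightarrow> ennreal_powr (ennreal a) b = ennreal (a powr b)"
  by (simp add: ennreal_powr_def)

lemma borel_measurable_ennreal_powr [measurable (raw)]:
  assumes [measurable]: "g \<in> borel_measurable M" "b \<in> borel_measurable M"
  shows "(\<lambda>x. ennreal_powr (g x) (b x)) \<in> borel_measurable M"
  unfolding ennreal_powr_def by measurable

lemma borel_measurable_conjugate_exponent:
  assumes "r \<in> borel_measurable M"
  shows "conjugate_exponent r \<in> borel_measurable M"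
  using assms unfolding conjugate_exponent_def by measurable

lemma conjugate_exponent_ratio:
  assumes "q x = ereal Q" "0 < q0" "q0 \<le> Q"
  shows "conjugate_exponent (\<lambda>x. q x / ereal q0) x = (if Q = q0 then \<infinity> else ereal (Q / (Q - q0)))"
  using assms by (auto simp: conjugate_exponent_def one_ereal_def divide_ereal_def zero_ereal_def field_simps)

text \<open>Young's inequality with both constants replaced by 1: the larger one of b^d and a^(P -
  p0), where d = 1 - p0 \<beta>, decides which term on the right dominates the product.\<close>

lemma young_exponents:
  fixes a b P Q p0 \<beta> :: real
  assumes ab: "0 \<le> a" "0 \<le> b" and \<beta>: "0 < \<beta>" and p0: "1 \<le> p0" "p0 * \<beta> < 1" "p0 \<le> P"
    and Q: "p0 / (1 - p0 * \<beta>) < Q" and PQ: "1 / Q = 1 / P - \<beta>"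
  shows "a powr p0 * b powr (1 - p0 * \<beta>) \<le> a powr P + b powr (Q / (Q - p0 / (1 - p0 * \<beta>)))"
proof -
  define d where "d = 1 - p0 * \<beta>"
  have d: "0 < d" using p0 by (simp add: d_def)
  define q0 where "q0 = p0 / d"
  have q0: "0 < q0" "q0 < Q" using p0 d Q by (auto simp: q0_def d_def)
  have dd: "1 / q0 = 1 / p0 - \<beta>" using p0 d unfolding q0_def by (simp add: d_def field_simps)
  have "1 / Q < 1 / q0" using q0 by (simp add: field_simps)
  then have "1 / P < 1 / p0" using dd PQ by simp
  then have P: "p0 < P" using p0 by (simp add: field_simps)
  have ex: "Q / (Q - q0) = d * P / (P - p0)"
  proof -
    have "q0 / Q = q0 / P - q0 * \<beta>" using PQ by (metis mult.right_neutral right_diff_distrib times_divide_eq_right)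
    also have "\<dots> = p0 / (d * P) - p0 * \<beta> / d" by (simp add: q0_def)
    finally have "1 - q0 / Q = (d * P - p0 + p0 * \<beta> * P) / (d * P)"
      using d P p0 by (simp add: field_simps)
    also have "d * P - p0 + p0 * \<beta> * P = P - p0" by (simp add: d_def algebra_simps)
    finally have "(Q - q0) / Q = (P - p0) / (d * P)" using q0 by (simp add: field_simps)
    then show ?thesis by (metis inverse_divide)
  qed
  show ?thesis
  proof (cases "b powr d \<le> a powr (P - p0)")
    case True
    then have "a powr p0 * b powr d \<le> a powr p0 * a powr (P - p0)"
      by (intro mult_left_mono) auto
    also have "\<dots> = a powr P" by (simp add: powr_add[symmetric])
    finally show ?thesis by (simp add: d_def add_increasing2)
  next
    case False
    then have "a powr (P - p0) \<le> b powr d" by simp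
    then have "(a powr (P - p0)) powr (p0 / (P - p0)) \<le> (b powr d) powr (p0 / (P - p0))"
      using p0 P by (intro powr_mono2) auto
    then have "a powr p0 \<le> b powr (d * p0 / (P - p0))"
      using P by (simp add: powr_powr)
    then have "a powr p0 * b powr d \<le> b powr (d * p0 / (P - p0)) * b powr d"
      by (intro mult_right_mono) auto
    also have "\<dots> = b powr (Q / (Q - q0))"
    proof -
      have "d * p0 / (P - p0) + d = d * P / (P - p0)" using P by (simp add: field_simps)
      then show ?thesis by (simp add: ex powr_add[symmetric])
    qed
    finally show ?thesis by (simp add: q0_def d_def add_increasing)
  qed
qed

section \<open>Variable exponent spaces\<close>

lemma AE_restrict_lebesgue:
  assumes "S \<in> sets lebesgue"
  shows "(AE x in restrict_space lebesgue S. P x) \<longleftrightarrow> (AE x in lebesgue. x \<in> S \<longrightarrow> P x)"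
  using assms by (simp add: AE_restrict_space_iff)

lemma modular_le_oneD:
  fixes p :: "'a::euclidean_space \<Rightarrow> ereal"
  assumes p: "p \<in> borel_measurable lebesgue" and g: "g \<in> borel_measurable lebesgue"
    and le: "modular p g \<le> 1"
  shows "(\<integral>\<^sup>+ x \<in> {x. p x \<noteq> \<infinity>}. ennreal_powr (g x) (real_of_ereal (p x)) \<partial>lebesgue) \<le> 1"
    and "AE x in lebesgue. p x = \<infinity> \<longrightarrow> g x \<le> 1"
proof -
  let ?E = "{x. p x = \<infinity>}"
  have E: "?E \<in> sets lebesgue"
    using measurable_sets[OF p, of "{\<infinity>}"] by (simp add: vimage_def)
  show "(\<integral>\<^sup>+ x \<in> {x. p x \<noteq> \<infinity>}. ennreal_powr (g x) (real_of_ereal (p x)) \<partial>lebesgue) \<le> 1"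
    using le unfolding modular_def by (meson le_add1 order_trans zero_le add_increasing2 order_refl)
  have "esssup (restrict_space lebesgue ?E) g \<le> 1"
    using le unfolding modular_def by (meson order_trans zero_le add_increasing order_refl)
  then have "AE x in restrict_space lebesgue ?E. g x \<le> 1"
    using esssup_AE[of g "restrict_space lebesgue ?E"] by (auto elim!: eventually_mono)
  then show "AE x in lebesgue. p x = \<infinity> \<longrightarrow> g x \<le> 1"
    by (simp add: AE_restrict_lebesgue[OF E])
qed

lemma esssup_restrict_le:
  fixes p :: "'a::euclidean_space \<Rightarrow> ereal" and g :: "'a \<Rightarrow> ennreal"
  assumes p: "p \<in> borel_measurable lebesgue" and g: "g \<in> borel_measurable lebesgue"
    and le: "AE x in lebesgue. p x = \<infinity> \<longrightarrow> g x \<le> c"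
  shows "esssup (restrict_space lebesgue {x. p x = \<infinity>}) g \<le> c"
proof (rule esssup_I)
  have E: "{x. p x = \<infinity>} \<in> sets lebesgue"
    using measurable_sets[OF p, of "{\<infinity>}"] by (simp add: vimage_def)
  show "g \<in> borel_measurable (restrict_space lebesgue {x. p x = \<infinity>})"
    using g by (rule measurable_restrict_space1)
  show "AE x in restrict_space lebesgue {x. p x = \<infinity>}. g x \<le> c"
    using le by (simp add: AE_restrict_lebesgue[OF E])
qed

lemma ennreal_divide_ennreal_real:
  "0 \<le> a \<Longrightarrow> 0 < c \<Longrightarrow> ennreal a / ennreal c = ennreal (a / c)"
  by (simp add: divide_ennreal)

text \<open>Scaling replaces normalization here: no extremal function for the duality between
  \<open>L\<^bsup>q/q0\<^esup>\<close> and its conjugate space is needed. With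
  \<open>K = \<integral> (u / L)\<^bsup>q\<^esup>\<close> the test function \<open>h = (u / L)\<^bsup>q - q0\<^esup>\<close> has norm at most
  \<open>K + 1\<close>, and the weighted bound gives \<open>2 K \<le> K + 1\<close> for the chosen constant.\<close>

lemma weighted_bound_truncation:
  fixes p q :: "'a::euclidean_space \<Rightarrow> ereal" and f u :: "'a \<Rightarrow> real" and F :: "'a \<Rightarrow> ennreal"
    and p0 q0 \<beta> C D l L Qm :: real
  defines "r \<equiv> conjugate_exponent (\<lambda>x. q x / ereal q0)"
  assumes [measurable]: "f \<in> borel_measurable lebesgue" "p \<in> borel_measurable lebesgue"
      "q \<in> borel_measurable lebesgue" "u \<in> borel_measurable lebesgue"
    and \<beta>: "0 < \<beta>" and p0: "1 \<le> p0" "p0 * \<beta> < 1" and q0: "q0 = p0 / (1 - p0 * \<beta>)"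
    and exps: "AE x in lebesgue. \<exists>P Q. p x = ereal P \<and> q x = ereal Q \<and> p0 \<le> P \<and> q0 \<le> Q \<and> Q \<le> Qm
        \<and> 1 / Q = 1 / P - \<beta>"
    and D: "0 < D" "\<And>h. h \<in> Lp_space r \<Longrightarrow>
        Lp_norm r (maximal_fun h) \<le> ennreal D * Lp_norm r (\<lambda>x. ennreal \<bar>h x\<bar>)"
    and C: "0 < C" and wb: "weighted_bound p0 \<beta> C f F"
    and l: "0 < l" "modular p (\<lambda>x. ennreal \<bar>f x\<bar> / ennreal l) \<le> 1"
    and L: "L = (4 * C * D * 2 powr (q0 / p0)) powr (1 / q0) * l"
    and u: "\<And>x. 0 \<le> u x" "\<And>x. u x \<le> N" "\<And>x. x \<notin> ball 0 N \<Longrightarrow> u x = 0" "\<And>x. ennreal (u x) \<le> F x"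
  shows "(\<integral>\<^sup>+ x. ennreal ((u x / L) powr real_of_ereal (q x)) \<partial>lebesgue) \<le> 1"
proof -
  define Q where "Q x = real_of_ereal (q x)" for x
  define P where "P x = real_of_ereal (p x)" for x
  define d where "d = 1 - p0 * \<beta>"
  have d: "0 < d" using p0 by (simp add: d_def)
  have q0p: "0 < q0" "p0 / q0 = d" "q0 * d = p0" using p0 d unfolding q0 d_def by auto
  have [measurable]: "Q \<in> borel_measurable lebesgue" "P \<in> borel_measurable lebesgue"
    unfolding Q_def P_def by measurable
  have ae: "AE x in lebesgue. p x = ereal (P x) \<and> q x = ereal (Q x) \<and> p0 \<le> P x \<and> q0 \<le> Q x \<and> Q x \<le> Qm
        \<and> 1 / Q x = 1 / P x - \<beta> \<and> r x = (if Q x = q0 then \<infinity> else ereal (Q x / (Q x - q0)))"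
    using exps
    by (rule eventually_mono) (use q0p conjugate_exponent_ratio[of q _ _ q0] in \<open>auto simp: Q_def P_def r_def\<close>)
  have [measurable]: "r \<in> borel_measurable lebesgue"
    unfolding r_def by (rule borel_measurable_conjugate_exponent) measurable
  \<comment> \<open>The 4 is 2 times 2: one factor leaves room to pick an admissible
    \<open>l2\<close> above the infimum that defines the norm of M h, the other yields K \<le>
    \<kappa> / 2. The power of 2 comes from the scaling constant \<open>c\<close>.\<close>
  define A where "A = 4 * C * D * 2 powr (q0 / p0)"
  have A: "0 < A" using C D by (simp add: A_def)
  have L0: "0 < L" using A l unfolding L A_def[symmetric] by simp
  have Lq0: "L powr q0 = A * l powr q0"
    unfolding L A_def[symmetric] using A l q0p by (simp add: powr_mult powr_powr)
  define U where "U x = u x / L" for x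
  have [measurable]: "U \<in> borel_measurable lebesgue" unfolding U_def by measurable
  have U0: "0 \<le> U x" for x using u(1)[of x] L0 by (simp add: U_def)
  \<comment> \<open>A crude bound on the support of \<open>u\<close>: the base is made at least 1 so
    that the variable exponent may be raised to \<open>Qm\<close>. It serves to show that
    \<open>K\<close> is finite.\<close>
  define b where "b = (max 1 (N / L)) powr Qm"
  have "(\<integral>\<^sup>+ x. ennreal (U x powr Q x) \<partial>lebesgue) \<le> (\<integral>\<^sup>+ x. ennreal b * indicator (ball (0::'a) N) x \<partial>lebesgue)"
  proof (rule nn_integral_mono_AE, rule eventually_mono[OF ae], goal_cases)
    case (1 x)
    note elim = this
    show ?case
    proof (cases "x \<in> ball 0 N")
      case True
      have "U x powr Q x \<le> (max 1 (N / L)) powr Q x"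
        using U0[of x] u(2)[of x] L0 elim q0p by (intro powr_mono2) (auto simp: U_def field_simps le_max_iff_disj)
      also have "\<dots> \<le> b" unfolding b_def using elim by (intro powr_mono) auto
      finally show ?thesis using True by (simp add: ennreal_leI)
    next
      case False
      with u(3)[OF this] show ?thesis by (simp add: U_def)
    qed
  qed
  also have "\<dots> < \<infinity>"
    using emeasure_lborel_ball_finite[of "0::'a" N] by (simp add: nn_integral_cmult ennreal_mult_less_top)
  finally obtain K where K: "0 \<le> K" "(\<integral>\<^sup>+ x. ennreal (U x powr Q x) \<partial>lebesgue) = ennreal K"
    by (cases "\<integral>\<^sup>+ x. ennreal (U x powr Q x) \<partial>lebesgue") auto
  \<comment> \<open>The integral and the essential supremum in the modular of h / \<kappa> are at
    most K / \<kappa> and 1 / \<kappa>, which add up to 1.\<close>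
  define \<kappa> where "\<kappa> = K + 1"
  have \<kappa>: "1 \<le> \<kappa>" using K by (simp add: \<kappa>_def)
  define h where "h x = U x powr (Q x - q0)" for x
  have [measurable]: "h \<in> borel_measurable lebesgue" unfolding h_def by measurable
  have h0: "0 \<le> h x" for x by (simp add: h_def)
  have "(\<integral>\<^sup>+ x \<in> {x. r x \<noteq> \<infinity>}. ennreal_powr (ennreal \<bar>h x\<bar> / ennreal \<kappa>) (real_of_ereal (r x)) \<partial>lebesgue)
    \<le> (\<integral>\<^sup>+ x. ennreal (1 / \<kappa>) * ennreal (U x powr Q x) \<partial>lebesgue)"
  proof (rule nn_integral_mono_AE, rule eventually_mono[OF ae], goal_cases)
    case (1 x)
    note elim = this
    show ?case
    proof (cases "r x = \<infinity>")
      case False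
      define \<rho> where "\<rho> = Q x / (Q x - q0)"
      have Qx: "q0 < Q x" "r x = ereal \<rho>" using elim False by (auto simp: \<rho>_def split: if_splits)
      have \<rho>: "1 \<le> \<rho>" using Qx q0p by (simp add: \<rho>_def field_simps)
      have "(h x / \<kappa>) powr \<rho> = U x powr Q x / \<kappa> powr \<rho>"
        using h0[of x] \<kappa> Qx by (simp add: powr_divide h_def powr_powr \<rho>_def)
      also have "\<dots> \<le> U x powr Q x / \<kappa>"
      proof -
        have "\<kappa> powr 1 \<le> \<kappa> powr \<rho>" using \<kappa> \<rho> by (intro powr_mono) auto
        then show ?thesis using \<kappa> by (intro divide_left_mono) auto
      qed
      finally have "ennreal ((h x / \<kappa>) powr \<rho>) \<le> ennreal (1 / \<kappa>) * ennreal (U x powr Q x)"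
        using \<kappa> by (simp add: ennreal_mult[symmetric] ennreal_leI)
      then show ?thesis
        using Qx \<kappa> h0[of x] by (simp add: ennreal_divide_ennreal_real ennreal_powr_ennreal)
    qed simp
  qed
  also have "\<dots> = ennreal (1 / \<kappa>) * ennreal K"
    unfolding K(2)[symmetric] by (rule nn_integral_cmult) measurable
  also have "\<dots> = ennreal (K / \<kappa>)" using K \<kappa> by (simp add: ennreal_mult[symmetric])
  finally have m1: "(\<integral>\<^sup>+ x \<in> {x. r x \<noteq> \<infinity>}. ennreal_powr (ennreal \<bar>h x\<bar> / ennreal \<kappa>) (real_of_ereal (r x)) \<partial>lebesgue)
    \<le> ennreal (K / \<kappa>)" .
  have m2: "esssup (restrict_space lebesgue {x. r x = \<infinity>}) (\<lambda>x. ennreal \<bar>h x\<bar> / ennreal \<kappa>) \<le> ennreal (1 / \<kappa>)"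
  proof (rule esssup_restrict_le)
    show "AE x in lebesgue. r x = \<infinity> \<longrightarrow> ennreal \<bar>h x\<bar> / ennreal \<kappa> \<le> ennreal (1 / \<kappa>)"
    proof (rule eventually_mono[OF ae], intro impI, goal_cases)
      case (1 x)
      then have "Q x = q0" by (auto split: if_splits)
      \<comment> \<open>Here \<open>h x\<close> is a zeroth power: 1, or 0 when the base is
        0.\<close>
      then have "h x \<le> 1" by (simp add: h_def powr_def)
      then show ?case using \<kappa> h0[of x] by (simp add: ennreal_divide_ennreal_real ennreal_leI divide_right_mono)
    qed
  qed measurable
  have "modular r (\<lambda>x. ennreal \<bar>h x\<bar> / ennreal \<kappa>) \<le> ennreal (K / \<kappa>) + ennreal (1 / \<kappa>)"
    unfolding modular_def by (intro add_mono m1 m2)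
  also have "\<dots> = 1"
    using K \<kappa> by (simp add: ennreal_plus[symmetric] \<kappa>_def add_divide_distrib[symmetric] del: ennreal_plus)
  finally have mh: "modular r (\<lambda>x. ennreal \<bar>h x\<bar> / ennreal \<kappa>) \<le> 1" .
  have hLp: "h \<in> Lp_space r"
    unfolding Lp_space_def using mh \<kappa> by (auto intro!: exI[of _ \<kappa>] elim: order_le_less_trans)
  have "Lp_norm r (\<lambda>x. ennreal \<bar>h x\<bar>) \<le> ennreal \<kappa>"
    unfolding Lp_norm_def using mh \<kappa> by (intro Inf_lower) auto
  then have "Lp_norm r (maximal_fun h) \<le> ennreal D * ennreal \<kappa>"
    using D(2)[OF hLp] by (meson mult_left_mono order_trans zero_le)
  also have "\<dots> < ennreal (2 * D * \<kappa>)"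
    using D \<kappa> by (simp add: ennreal_mult[symmetric] ennreal_less_iff)
  finally obtain l2 where l2: "0 < l2" "l2 < 2 * D * \<kappa>" "modular r (\<lambda>x. maximal_fun h x / ennreal l2) \<le> 1"
    unfolding Lp_norm_def Inf_less_iff by (auto simp: ennreal_less_iff)
  have "(\<lambda>x. maximal_fun h x / ennreal l2) \<in> borel_measurable lebesgue" by measurable
  note mM = modular_le_oneD[OF \<open>r \<in> borel_measurable lebesgue\<close> this l2(3)]
  \<comment> \<open>The two parts of the modular together cover all points: an infinite value of M h
    makes the integrand infinite where \<open>r\<close> is finite and violates the essential bound
    where \<open>r\<close> is infinite.\<close>
  have "AE x in lebesgue. ennreal_powr (maximal_fun h x / ennreal l2) (real_of_ereal (r x))
      * indicator {x. r x \<noteq> \<infinity>} x \<noteq> \<infinity>"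
    using mM(1) by (intro nn_integral_PInf_AE) (auto simp: top_unique)
  then have Mfin: "AE x in lebesgue. maximal_fun h x \<noteq> \<infinity>"
    using mM(2)
  proof eventually_elim
    case (elim x)
    show ?case
      using elim l2(1) by (cases "r x = \<infinity>") (auto simp: ennreal_powr_def ennreal_top_divide top_unique)
  qed
  define v0 where "v0 x = enn2real (maximal_fun h x)" for x
  have v0: "0 \<le> v0 x" for x by (simp add: v0_def)
  have [measurable]: "v0 \<in> borel_measurable lebesgue" unfolding v0_def by measurable
  have dom0: "ball_dominated h v0"
    unfolding v0_def by (rule ball_dominated_maximal_fun[OF h0 Mfin])
  \<comment> \<open>Chosen so that c^d = 2 l2^d l^p0: the weighted integral of f against v0 / c is
    then half of the corresponding integral of f / l against v0 / l2, which Young's inequality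
    bounds by two modulars of at most 1 each.\<close>
  define c where "c = 2 powr (q0 / p0) * l2 * l powr q0"
  have c: "0 < c" using l2 l by (simp add: c_def)
  have dom: "ball_dominated (\<lambda>x. h x / c) (\<lambda>x. v0 x / c)"
    by (rule ball_dominated_divide[OF _ dom0 c]) measurable
  have cd: "c powr d = 2 * l2 powr d * l powr p0"
  proof -
    have "q0 / p0 * d = 1" using q0p p0 d by (simp add: field_simps)
    then show ?thesis unfolding c_def using l2 l q0p by (simp add: powr_mult powr_powr)
  qed
  have "(\<lambda>x. ennreal \<bar>f x\<bar> / ennreal l) \<in> borel_measurable lebesgue" by measurable
  note mf = modular_le_oneD(1)[OF \<open>p \<in> borel_measurable lebesgue\<close> this l(2)]
  have "(\<integral>\<^sup>+ z. ennreal (\<bar>f z\<bar> powr p0 * (v0 z / c) powr (1 - p0 * \<beta>)) \<partial>lebesgue)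
    \<le> (\<integral>\<^sup>+ z. ennreal (1 / 2) *
        (ennreal_powr (ennreal \<bar>f z\<bar> / ennreal l) (real_of_ereal (p z)) * indicator {x. p x \<noteq> \<infinity>} z
         + ennreal_powr (maximal_fun h z / ennreal l2) (real_of_ereal (r z)) * indicator {x. r x \<noteq> \<infinity>} z) \<partial>lebesgue)"
  proof (rule nn_integral_mono_AE, rule eventually_mono[OF eventually_conj[OF ae eventually_conj[OF Mfin mM(2)]]], goal_cases)
    case (1 z)
    note elim = 1[THEN conjunct1] 1[THEN conjunct2, THEN conjunct1] 1[THEN conjunct2, THEN conjunct2]
    define a where "a = \<bar>f z\<bar> / l"
    define w where "w = v0 z / l2"
    have a: "0 \<le> a" and w: "0 \<le> w" using l l2 v0[of z] by (auto simp: a_def w_def)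
    have pz: "p z = ereal (P z)" and rz: "r z = (if Q z = q0 then \<infinity> else ereal (Q z / (Q z - q0)))"
      and PQ: "p0 \<le> P z" "q0 \<le> Q z" "1 / Q z = 1 / P z - \<beta>" using elim by auto
    have "maximal_fun h z = ennreal (v0 z)" using elim(2) by (simp add: v0_def less_top)
    then have Mw: "maximal_fun h z / ennreal l2 = ennreal w"
      using v0 l2 by (simp add: w_def ennreal_divide_ennreal_real)
    have fa: "ennreal \<bar>f z\<bar> / ennreal l = ennreal a"
      using l by (simp add: a_def ennreal_divide_ennreal_real)
    have eq: "\<bar>f z\<bar> powr p0 * (v0 z / c) powr (1 - p0 * \<beta>) = 1 / 2 * (a powr p0 * w powr d)"
      unfolding d_def[symmetric] a_def w_def using l l2 c v0[of z]
      by (simp add: powr_divide cd)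
    have "ennreal (a powr p0 * w powr d) \<le>
        ennreal_powr (ennreal a) (P z) + ennreal_powr (ennreal w) (real_of_ereal (r z)) * indicator {x. r x \<noteq> \<infinity>} z"
    \<comment> \<open>Where Q z = q0 also P z = p0, and Young's inequality degenerates; the bound M
      h / l2 \<le> 1 from the essential supremum replaces it.\<close>
    proof (cases "Q z = q0")
      case True
      have "1 / q0 = 1 / p0 - \<beta>" using p0 d unfolding q0 by (simp add: d_def field_simps)
      with PQ(3) True have "1 / P z = 1 / p0" by simp
      then have "P z = p0" using p0 PQ(1) by (simp add: field_simps)
      have "ennreal w \<le> 1" using elim(3) rz True Mw by simp
      then have "w \<le> 1" using w by simp
      then have "w powr d \<le> 1" using w d powr_mono2[of d w 1] by simp
      then have "a powr p0 * w powr d \<le> a powr p0"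
        using mult_left_mono[of "w powr d" 1 "a powr p0"] by simp
      then show ?thesis using a \<open>P z = p0\<close> rz True by (simp add: ennreal_powr_ennreal ennreal_leI)
    next
      case False
      have "a powr p0 * w powr d \<le> a powr P z + w powr (Q z / (Q z - q0))"
        using young_exponents[OF a w \<beta> p0 PQ(1), of "Q z"] False PQ by (simp add: q0 d_def)
      then show ?thesis using rz False a w
        by (simp add: ennreal_powr_ennreal ennreal_plus[symmetric] ennreal_leI del: ennreal_plus)
    qed
    then have "ennreal (1 / 2) * ennreal (a powr p0 * w powr d) \<le> ennreal (1 / 2) *
        (ennreal_powr (ennreal a) (P z) + ennreal_powr (ennreal w) (real_of_ereal (r z)) * indicator {x. r x \<noteq> \<infinity>} z)"
      by (rule mult_left_mono) simp
    moreover have "(indicator {x. p x \<noteq> \<infinity>} z :: ennreal) = 1" using pz by simp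
    ultimately show ?case
      unfolding eq Mw fa by (simp add: pz ennreal_mult[symmetric] del: ennreal_half)
  qed
  also have "\<dots> = ennreal (1 / 2) *
      ((\<integral>\<^sup>+ x \<in> {x. p x \<noteq> \<infinity>}. ennreal_powr (ennreal \<bar>f x\<bar> / ennreal l) (real_of_ereal (p x)) \<partial>lebesgue)
       + (\<integral>\<^sup>+ x \<in> {x. r x \<noteq> \<infinity>}. ennreal_powr (maximal_fun h x / ennreal l2) (real_of_ereal (r x)) \<partial>lebesgue))"
    by (subst nn_integral_cmult, measurable) (subst nn_integral_add, measurable)
  also have "\<dots> \<le> ennreal (1 / 2) * (1 + 1)"
    by (intro mult_left_mono add_mono mf mM(1)) simp
  also have "\<dots> = 1"
  proof -
    have "(1 + 1 :: ennreal) = ennreal 2" by simp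
    then show ?thesis by (simp only: ennreal_mult[symmetric]) (simp add: ennreal_mult[symmetric])
  qed
  finally have norm1: "(\<integral>\<^sup>+ z. ennreal (\<bar>f z\<bar> powr p0 * (v0 z / c) powr (1 - p0 * \<beta>)) \<partial>lebesgue) \<le> 1" .
  have bound: "(\<integral>\<^sup>+ z. ennreal (u z powr q0 * (h z / c)) \<partial>lebesgue) \<le> ennreal C"
    unfolding q0
    by (rule wb[unfolded weighted_bound_def, rule_format, OF _ _ _ _ _ _ _ dom norm1])
      (use h0 v0 c u in auto)
  have "(\<integral>\<^sup>+ z. ennreal (u z powr q0 * (h z / c)) \<partial>lebesgue)
    = (\<integral>\<^sup>+ z. ennreal (L powr q0 / c) * ennreal (U z powr Q z) \<partial>lebesgue)"
  proof (rule nn_integral_cong)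
    fix z
    have "u z = L * U z" using L0 by (simp add: U_def)
    then have "u z powr q0 * h z = L powr q0 * (U z powr q0 * U z powr (Q z - q0))"
      using L0 U0[of z] by (simp add: powr_mult h_def)
    also have "U z powr q0 * U z powr (Q z - q0) = U z powr Q z"
      by (simp add: powr_add[symmetric])
    finally show "ennreal (u z powr q0 * (h z / c)) = ennreal (L powr q0 / c) * ennreal (U z powr Q z)"
      using c by (simp add: ennreal_mult[symmetric])
  qed
  also have "\<dots> = ennreal (L powr q0 / c) * ennreal K"
    unfolding K(2)[symmetric] by (rule nn_integral_cmult) measurable
  also have "\<dots> = ennreal (L powr q0 / c * K)" using c K by (simp add: ennreal_mult[symmetric])
  finally have "L powr q0 / c * K \<le> C" using bound C by (simp add: ennreal_le_iff)
  then have "A * l powr q0 * K \<le> C * c" using c by (simp add: Lq0 field_simps)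
  then have "A * K \<le> C * (2 powr (q0 / p0) * l2)" using l by (simp add: c_def)
  also have "\<dots> \<le> C * (2 powr (q0 / p0) * (2 * D * \<kappa>))"
    using C l2 by (intro mult_left_mono) auto
  also have "\<dots> = A * (\<kappa> / 2)" by (simp add: A_def)
  finally have "K \<le> \<kappa> / 2" using A by (simp add: mult_le_cancel_left_pos)
  then have "K \<le> 1" by (simp add: \<kappa>_def)
  then show ?thesis using K unfolding U_def Q_def by (simp add: ennreal_le_iff)
qed

section \<open>Removal of the truncation\<close>

lemma ennreal_powr_le_SUP_truncation:
  fixes L s :: real and y :: ennreal and x :: "'a::real_normed_vector"
  assumes L: "0 < L" and s: "0 < s"
  shows "ennreal_powr (y / ennreal L) s
    \<le> (SUP N. ennreal ((enn2real (min y (of_nat N)) * indicator (ball 0 (real N)) x / L) powr s))"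
    (is "_ \<le> (SUP N. ?G N)")
proof (cases y)
  case (real a)
  obtain N where "max a (norm x) < real N" using reals_Archimedean2 by blast
  then have N: "a \<le> real N" "x \<in> ball 0 (real N)" by auto
  have "ennreal a \<le> of_nat N"
    using ennreal_leI[OF N(1)] by (simp add: ennreal_of_nat_eq_real_of_nat)
  then have "min y (of_nat N) = ennreal a" using real by (simp add: min_absorb1)
  then have "?G N = ennreal ((a / L) powr s)"
    using N(2) real by simp
  moreover have "ennreal_powr (y / ennreal L) s = ennreal ((a / L) powr s)"
    using real L by (simp add: ennreal_divide_ennreal_real ennreal_powr_ennreal)
  ultimately have eq: "ennreal_powr (y / ennreal L) s = ?G N" by (simp only:)
  show ?thesis unfolding eq by (rule SUP_upper) simp
next
  case top
  \<comment> \<open>For infinite \<open>y\<close> the term with index N is (N / L)^s once the ball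
    contains x, and s > 0 makes it unbounded.\<close>
  have "(SUP N. ?G N) = \<infinity>"
    unfolding infinity_ennreal_def
  proof (rule ennreal_SUP_eq_top)
    fix n :: nat
    obtain N where N: "max (norm x) (L * real n powr (1 / s)) < real N" using reals_Archimedean2 by blast
    have "real n powr (1 / s) \<le> real N / L" using N L by (simp add: field_simps)
    then have "(real n powr (1 / s)) powr s \<le> (real N / L) powr s"
      using s by (intro powr_mono2) auto
    then have "real n \<le> (real N / L) powr s" using s by (simp add: powr_powr)
    moreover have "?G N = ennreal ((real N / L) powr s)"
    proof -
      have "min y (of_nat N) = ennreal (real N)"
        using top by (simp add: min_absorb2 ennreal_of_nat_eq_real_of_nat)
      then show ?thesis using N by simp
    qed
    ultimately have "of_nat n \<le> ?G N"
      by (simp only: ennreal_of_nat_eq_real_of_nat ennreal_leI)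
    then show "\<exists>i\<in>UNIV. of_nat n \<le> ?G i" by (rule bexI) simp
  qed
  then show ?thesis by (simp only: infinity_ennreal_def top_greatest)
qed

lemma weighted_bound_modular:
  fixes p q :: "'a::euclidean_space \<Rightarrow> ereal" and f :: "'a \<Rightarrow> real" and F :: "'a \<Rightarrow> ennreal"
    and p0 q0 \<beta> C D l L Qm :: real
  defines "r \<equiv> conjugate_exponent (\<lambda>x. q x / ereal q0)"
  assumes [measurable]: "f \<in> borel_measurable lebesgue" "p \<in> borel_measurable lebesgue"
      "q \<in> borel_measurable lebesgue" "F \<in> borel_measurable lebesgue"
    and \<beta>: "0 < \<beta>" and p0: "1 \<le> p0" "p0 * \<beta> < 1" and q0: "q0 = p0 / (1 - p0 * \<beta>)"
    and exps: "AE x in lebesgue. \<exists>P Q. p x = ereal P \<and> q x = ereal Q \<and> p0 \<le> P \<and> q0 \<le> Q \<and> Q \<le> Qm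
        \<and> 1 / Q = 1 / P - \<beta>"
    and D: "0 < D" "\<And>h. h \<in> Lp_space r \<Longrightarrow>
        Lp_norm r (maximal_fun h) \<le> ennreal D * Lp_norm r (\<lambda>x. ennreal \<bar>h x\<bar>)"
    and C: "0 < C" and wb: "weighted_bound p0 \<beta> C f F"
    and l: "0 < l" "modular p (\<lambda>x. ennreal \<bar>f x\<bar> / ennreal l) \<le> 1"
    and L: "L = (4 * C * D * 2 powr (q0 / p0)) powr (1 / q0) * l"
  shows "modular q (\<lambda>x. F x / ennreal L) \<le> 1"
proof -
  have q0p: "0 < q0" using p0 unfolding q0 by simp
  have L0: "0 < L" unfolding L using C D l by simp
  define u where "u N x = enn2real (min (F x) (of_nat N)) * indicator (ball (0::'a) (real N)) x" for N :: nat and x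
  have [measurable]: "u N \<in> borel_measurable lebesgue" for N
    unfolding u_def by measurable
  have u0: "0 \<le> u N x" for N x by (simp add: u_def)
  have fin: "min (F x) (of_nat N) < top" for x N
    by (simp add: min_less_iff_disj of_nat_less_top)
  have uF: "ennreal (u N x) \<le> F x" for N x
    using fin[of x N] by (auto simp: u_def indicator_def)
  have uN: "u N x \<le> real N" for N x
  proof -
    have "enn2real (min (F x) (of_nat N)) \<le> real N"
      by (intro enn2real_leI) (auto simp: ennreal_of_nat_eq_real_of_nat)
    then show ?thesis by (auto simp: u_def indicator_def)
  qed
  have one: "(\<integral>\<^sup>+ x. ennreal ((u N x / L) powr real_of_ereal (q x)) \<partial>lebesgue) \<le> 1" for N
    by (rule weighted_bound_truncation[where u="u N" and N="real N", OF assms(2-4) _ \<beta> p0 q0 exps D(1) D(2)[unfolded r_def] C wb l L])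
      (use u0 uN uF in \<open>auto simp: u_def\<close>)
  \<comment> \<open>Monotone convergence is applied with monotonicity at every point, but
    \<open>exps\<close> gives positive exponents only almost everywhere. The \<open>max 0\<close>
    changes exponents on a null set and makes the powers monotone throughout.\<close>
  have mono: "incseq (\<lambda>N x. ennreal ((u N x / L) powr max 0 (real_of_ereal (q x))))"
    unfolding incseq_def le_fun_def
  proof (intro allI impI ennreal_leI powr_mono2)
    fix m n :: nat and x assume mn: "m \<le> n"
    have "enn2real (min (F x) (of_nat m)) \<le> enn2real (min (F x) (of_nat n))"
      using mn fin[of x n] by (intro enn2real_mono min.mono) auto
    moreover have "ball (0::'a) (real m) \<subseteq> ball 0 (real n)" using mn by (intro subset_ball) simp
    ultimately have "u m x \<le> u n x"
      unfolding u_def by (intro mult_mono) (auto simp: indicator_def)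
    then show "u m x / L \<le> u n x / L" using L0 by (simp add: divide_right_mono)
  qed (use u0 L0 in auto)
  have qpos: "AE x in lebesgue. q x \<noteq> \<infinity> \<and> 0 < real_of_ereal (q x)"
    using exps by (rule eventually_mono) (use q0p in auto)
  have "(\<integral>\<^sup>+ x \<in> {x. q x \<noteq> \<infinity>}. ennreal_powr (F x / ennreal L) (real_of_ereal (q x)) \<partial>lebesgue)
    \<le> (\<integral>\<^sup>+ x. (SUP N. ennreal ((u N x / L) powr max 0 (real_of_ereal (q x)))) \<partial>lebesgue)"
  proof (rule nn_integral_mono_AE, rule eventually_mono[OF qpos], goal_cases)
    case (1 x)
    then have "max 0 (real_of_ereal (q x)) = real_of_ereal (q x)" by simp
    with 1 ennreal_powr_le_SUP_truncation[OF L0, of "real_of_ereal (q x)" "F x" x] show ?case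
      by (simp add: u_def indicator_def)
  qed
  also have "\<dots> = (SUP N. (\<integral>\<^sup>+ x. ennreal ((u N x / L) powr max 0 (real_of_ereal (q x))) \<partial>lebesgue))"
    by (rule nn_integral_monotone_convergence_SUP[OF mono]) measurable
  also have "\<dots> \<le> 1"
  proof (rule SUP_least)
    fix N
    have "(\<integral>\<^sup>+ x. ennreal ((u N x / L) powr max 0 (real_of_ereal (q x))) \<partial>lebesgue)
      = (\<integral>\<^sup>+ x. ennreal ((u N x / L) powr real_of_ereal (q x)) \<partial>lebesgue)"
      by (rule nn_integral_cong_AE, rule eventually_mono[OF qpos]) (auto simp: max_def)
    with one[of N] show "(\<integral>\<^sup>+ x. ennreal ((u N x / L) powr max 0 (real_of_ereal (q x))) \<partial>lebesgue) \<le> 1"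
      by simp
  qed
  finally have 1: "(\<integral>\<^sup>+ x \<in> {x. q x \<noteq> \<infinity>}. ennreal_powr (F x / ennreal L) (real_of_ereal (q x)) \<partial>lebesgue) \<le> 1" .
  \<comment> \<open>\<open>q\<close> is finite almost everywhere, so this essential supremum is
    taken over a null set.\<close>
  have 2: "esssup (restrict_space lebesgue {x. q x = \<infinity>}) (\<lambda>x. F x / ennreal L) \<le> 0"
    by (rule esssup_restrict_le, measurable, rule eventually_mono[OF qpos]) auto
  show ?thesis
    unfolding modular_def using add_mono[OF 1 2] by simp
qed

lemma weighted_bound_Lp_norm:
  fixes p q :: "'a::euclidean_space \<Rightarrow> ereal" and f :: "'a \<Rightarrow> real" and F :: "'a \<Rightarrow> ennreal"
    and p0 q0 \<beta> C D Qm :: real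
  defines "r \<equiv> conjugate_exponent (\<lambda>x. q x / ereal q0)"
  assumes "f \<in> borel_measurable lebesgue" "p \<in> borel_measurable lebesgue"
      "q \<in> borel_measurable lebesgue" "F \<in> borel_measurable lebesgue"
    and \<beta>: "0 < \<beta>" and p0: "1 \<le> p0" "p0 * \<beta> < 1" and q0: "q0 = p0 / (1 - p0 * \<beta>)"
    and exps: "AE x in lebesgue. \<exists>P Q. p x = ereal P \<and> q x = ereal Q \<and> p0 \<le> P \<and> q0 \<le> Q \<and> Q \<le> Qm
        \<and> 1 / Q = 1 / P - \<beta>"
    and D: "0 < D" "\<And>h. h \<in> Lp_space r \<Longrightarrow>
        Lp_norm r (maximal_fun h) \<le> ennreal D * Lp_norm r (\<lambda>x. ennreal \<bar>h x\<bar>)"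
    and C: "0 < C" and wb: "weighted_bound p0 \<beta> C f F"
  shows "Lp_norm q F \<le> ennreal ((4 * C * D * 2 powr (q0 / p0)) powr (1 / q0)) * Lp_norm p (\<lambda>x. ennreal \<bar>f x\<bar>)"
proof -
  define A where "A = (4 * C * D * 2 powr (q0 / p0)) powr (1 / q0)"
  have A: "0 < A" unfolding A_def using C D by simp
  \<comment> \<open>With the constant moved to the left, the norm of f stands alone as an infimum,
    and the claim can be tested against each admissible \<open>l\<close>.\<close>
  have "ennreal (1 / A) * Lp_norm q F \<le> Lp_norm p (\<lambda>x. ennreal \<bar>f x\<bar>)"
    unfolding Lp_norm_def[of p]
  proof (rule Inf_greatest, safe)
    fix l :: real assume l: "0 < l" "modular p (\<lambda>x. ennreal \<bar>f x\<bar> / ennreal l) \<le> 1"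
    have "modular q (\<lambda>x. F x / ennreal (A * l)) \<le> 1"
      by (rule weighted_bound_modular[OF assms(2-5) \<beta> p0 q0 exps D(1) D(2)[unfolded r_def] C wb l]) (simp_all add: A_def)
    then have "Lp_norm q F \<le> ennreal (A * l)"
      unfolding Lp_norm_def using A l by (intro Inf_lower) auto
    then have "ennreal (1 / A) * Lp_norm q F \<le> ennreal (1 / A) * ennreal (A * l)"
      by (intro mult_left_mono) auto
    also have "\<dots> = ennreal l" using A l by (simp add: ennreal_mult[symmetric])
    finally show "ennreal (1 / A) * Lp_norm q F \<le> ennreal l" .
  qed
  then have "ennreal A * (ennreal (1 / A) * Lp_norm q F) \<le> ennreal A * Lp_norm p (\<lambda>x. ennreal \<bar>f x\<bar>)"
    by (intro mult_left_mono) auto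
  moreover have "ennreal A * (ennreal (1 / A) * Lp_norm q F) = Lp_norm q F"
    using A by (simp add: mult.assoc[symmetric] ennreal_mult[symmetric])
  ultimately show ?thesis unfolding A_def by simp
qed

section \<open>Level sets of the fractional maximal function and the essential infimum\<close>

lemma superlevel_eq_frac_maximal_fun:
  fixes f :: "'a::euclidean_space \<Rightarrow> real"
  assumes t: "0 \<le> t"
  shows "superlevel (1 - \<alpha> / DIM('a)) f t = {x. ennreal t < frac_maximal_fun \<alpha> f x}"
proof -
  have iff: "ennreal (t * c) < I \<longleftrightarrow> ennreal t < I / ennreal c" if c: "0 < c" for c and I :: ennreal
  proof -
    have "I \<le> ennreal (t * c) \<longleftrightarrow> I / ennreal c \<le> ennreal t"
    proof
      assume "I \<le> ennreal (t * c)"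
      then have "I / ennreal c \<le> ennreal (t * c) / ennreal c" by (rule divide_right_mono_ennreal)
      then show "I / ennreal c \<le> ennreal t" using t c by (simp add: ennreal_divide_ennreal_real)
    next
      assume "I / ennreal c \<le> ennreal t"
      then have "I / ennreal c * ennreal c \<le> ennreal t * ennreal c" by (rule mult_right_mono) simp
      moreover have "I / ennreal c * ennreal c = I"
        using c by (simp add: ennreal_divide_times ennreal_divide_self mult_divide_eq_ennreal)
      ultimately show "I \<le> ennreal (t * c)" using t c by (simp add: ennreal_mult)
    qed
    then show ?thesis by (simp add: not_le[symmetric])
  qed
  have "0 < measure lebesgue (ball y r) powr (1 - \<alpha> / DIM('a))" if "x \<in> ball y r" for x y :: 'a and r
    using measure_ball_pos[OF ball_radius_pos[OF that]] by simp
  then have "superlevel (1 - \<alpha> / DIM('a)) f t = {x. \<exists>y r. x \<in> ball y r \<and>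
      ennreal t < (\<integral>\<^sup>+ z \<in> ball y r. ennreal \<bar>f z\<bar> \<partial>lebesgue)
        / ennreal (measure lebesgue (ball y r) powr (1 - \<alpha> / DIM('a)))}"
    unfolding superlevel_def by (intro Collect_cong ex_cong1 conj_cong refl iff)
  also have "\<dots> = {x. ennreal t < frac_maximal_fun \<alpha> f x}"
    unfolding frac_maximal_fun_def less_Sup_iff by blast
  finally show ?thesis .
qed

text \<open>The essential lower bounds may form an uncountable set, but their supremum is already
  that of a sequence, and countably many null sets can be discarded together.\<close>

lemma AE_ess_inf_le: "AE x in lebesgue. ess_inf p \<le> p x"
proof -
  let ?S = "{c. AE x in lebesgue. c \<le> p x}"
  have "?S \<noteq> {}" by (auto intro!: exI[of _ "-\<infinity>"])
  then obtain c where c: "\<And>n::nat. c n \<in> ?S" "Sup ?S = (SUP n. c n)"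
    using Sup_countable_SUP[of ?S] by (metis (no_types, lifting) image_subset_iff UNIV_I)
  have "AE x in lebesgue. \<forall>n. c n \<le> p x"
    using c(1) by (simp add: AE_all_countable)
  then show ?thesis
    unfolding ess_inf_def c(2) by (rule eventually_mono) (auto intro: SUP_least)
qed

theorem lemma1:
  fixes \<alpha> q0 :: real
    and p q :: "real ^ 'n \<Rightarrow> ereal"
  assumes "0 < \<alpha>" and "\<alpha> < real CARD('n)"
    and "p \<in> variable_exponents"
    and "1 \<le> ess_inf p" and "ess_inf p \<le> ess_sup p"
    and "ess_sup p < ereal (real CARD('n) / \<alpha>)"
    and "q \<in> variable_exponents"
    and "AE x in lebesgue. 1 / p x - 1 / q x = ereal (\<alpha> / real CARD('n))"
    and "1 / ess_inf p - 1 / ereal q0 = ereal (\<alpha> / real CARD('n))"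
    and "maximal_bounded_on (conjugate_exponent (\<lambda>x. q x / ereal q0))"
  shows "(1 < ess_inf p \<longrightarrow>
           (\<exists>C::real. 0 < C \<and> (\<forall>f \<in> Lp_space p.
              Lp_norm q (frac_maximal_fun \<alpha> f)
                \<le> ennreal C * Lp_norm p (\<lambda>x. ennreal \<bar>f x\<bar>))))
       \<and> (ess_inf p = 1 \<longrightarrow>
           (\<exists>C::real. 0 < C \<and> (\<forall>f \<in> Lp_space p. \<forall>l::real. 0 < l \<longrightarrow>
              Lp_norm q (\<lambda>x. ennreal l * indicator {x. frac_maximal_fun \<alpha> f x > ennreal l} x)
                \<le> ennreal C * Lp_norm p (\<lambda>x. ennreal \<bar>f x\<bar>))))"
proof -
  define n where "n = real CARD('n)"
  define \<beta> where "\<beta> = \<alpha> / n"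
  have n: "0 < n" by (simp add: n_def)
  have \<beta>: "0 < \<beta>" "\<beta> < 1" using assms(1,2) n by (auto simp: \<beta>_def n_def)
  have dim: "1 - \<alpha> / DIM(real ^ 'n) = 1 - \<beta>" by (simp add: \<beta>_def n_def)
  have nb: "real CARD('n) / \<alpha> = 1 / \<beta>" using assms(1) by (simp add: \<beta>_def n_def)
  have fin: "ess_sup p < ereal (1 / \<beta>)" using assms(6) unfolding nb .
  obtain p1 where p1: "ess_sup p = ereal p1" "p1 < 1 / \<beta>"
    using assms(4,5) fin by (cases "ess_sup p") auto
  obtain p0 where p0: "ess_inf p = ereal p0" "1 \<le> p0" "p0 \<le> p1"
    using assms(4,5) p1 by (cases "ess_inf p") auto
  have p1\<beta>: "p1 * \<beta> < 1" "0 < p1" using p1(2) p0 \<beta> by (auto simp: field_simps)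
  have "p0 * \<beta> \<le> p1 * \<beta>" using p0 \<beta> by (intro mult_right_mono) auto
  then have p0\<beta>: "p0 * \<beta> < 1" using p1\<beta> by linarith
  have eq0: "1 / ereal p0 - 1 / ereal q0 = ereal \<beta>"
    using assms(9) by (simp add: p0 \<beta>_def n_def)
  \<comment> \<open>For q0 = 0 the quotient 1 / q0 is \<infinity> in \<open>ereal\<close>, and the
    difference could not be real.\<close>
  then have "q0 \<noteq> 0" using p0(2) by (auto simp: divide_ereal_def one_ereal_def)
  then have "1 / p0 - 1 / q0 = \<beta>"
    using eq0 p0(2) by (simp add: divide_ereal_def one_ereal_def divide_inverse)
  then have inv_q0: "1 / q0 = (1 - p0 * \<beta>) / p0" using p0(2) by (simp add: field_simps)
  then have q0: "q0 = p0 / (1 - p0 * \<beta>)" by (metis inverse_divide inverse_eq_divide inverse_inverse_eq)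
  have q0p: "0 < q0" using p0(2) p0\<beta> unfolding q0 by simp
  have meas: "p \<in> borel_measurable lebesgue" "q \<in> borel_measurable lebesgue" "\<And>x. 1 \<le> q x"
    using assms(3,7) by (auto simp: variable_exponents_def)
  have sup: "AE x in lebesgue. p x \<le> ereal p1"
    using esssup_AE[of p lebesgue] p1(1) by (simp add: ess_sup_def)
  have inf: "AE x in lebesgue. ereal p0 \<le> p x"
    using AE_ess_inf_le[of p] p0(1) by simp
  \<comment> \<open>The value of q that belongs to p = \<open>p1\<close>, the essential supremum of
    \<open>p\<close>. It is a genuine bound because p1 < 1/\<beta>, and the truncation argument uses
    it to keep its integral finite.\<close>
  define Qm where "Qm = 1 / (1 / p1 - \<beta>)"
  have exps: "AE x in lebesgue. \<exists>P Q. p x = ereal P \<and> q x = ereal Q \<and> p0 \<le> P \<and> q0 \<le> Q \<and> Q \<le> Qm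
        \<and> 1 / Q = 1 / P - \<beta>"
    using sup inf assms(8)
  proof eventually_elim
    case (elim x)
    obtain P where P: "p x = ereal P" "p0 \<le> P" "P \<le> p1"
      using elim(1,2) by (cases "p x") auto
    have eq: "1 / ereal P - 1 / q x = ereal \<beta>"
      using elim(3) by (simp add: P \<beta>_def n_def)
    have inv: "1 / p1 \<le> 1 / P" "1 / P \<le> 1 / p0" "\<beta> < 1 / p1"
      using P p0(2) p1\<beta> by (auto simp: field_simps)
    have "q x \<noteq> \<infinity>" using eq P p0(2) inv by (auto simp: divide_ereal_def one_ereal_def divide_inverse)
    then obtain Q where Q: "q x = ereal Q" "1 \<le> Q"
      using meas(3)[of x] by (cases "q x") auto
    have eqQ: "1 / Q = 1 / P - \<beta>"
      using eq Q P p0(2) by (auto simp: divide_ereal_def one_ereal_def divide_inverse)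
    have "1 / p0 - \<beta> = 1 / q0" using \<open>1 / p0 - 1 / q0 = \<beta>\<close> by simp
    then have "1 / Q \<le> 1 / q0" using eqQ inv by linarith
    then have "q0 \<le> Q" using q0p Q by (simp add: field_simps)
    moreover have "Q \<le> Qm"
    proof -
      have "0 < 1 / p1 - \<beta>" "1 / p1 - \<beta> \<le> 1 / Q" using inv eqQ by auto
      then have "1 / (1 / Q) \<le> 1 / (1 / p1 - \<beta>)" by (intro divide_left_mono) (use Q in auto)
      then show ?thesis by (simp add: Qm_def)
    qed
    ultimately show ?case using P Q eqQ by blast
  qed
  obtain D where D: "0 < D" "\<And>h. h \<in> Lp_space (conjugate_exponent (\<lambda>x. q x / ereal q0)) \<Longrightarrow>
        Lp_norm (conjugate_exponent (\<lambda>x. q x / ereal q0)) (maximal_fun h)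
        \<le> ennreal D * Lp_norm (conjugate_exponent (\<lambda>x. q x / ereal q0)) (\<lambda>x. ennreal \<bar>h x\<bar>)"
    using assms(10) unfolding maximal_bounded_on_def by auto
  define A where "A C = (4 * C * D * 2 powr (q0 / p0)) powr (1 / q0)" for C
  have A: "0 < A C" if "0 < C" for C using that D(1) by (simp add: A_def)
  have bound: "Lp_norm q F \<le> ennreal (A C) * Lp_norm p (\<lambda>x. ennreal \<bar>f x\<bar>)"
    if "f \<in> Lp_space p" "F \<in> borel_measurable lebesgue" "0 < C" "weighted_bound p0 \<beta> C f F" for f F C
  proof -
    have "f \<in> borel_measurable lebesgue" using that(1) by (simp add: Lp_space_def)
    then show ?thesis unfolding A_def
      by (rule weighted_bound_Lp_norm[OF _ meas(1,2) that(2) \<beta>(1) p0(2) p0\<beta> q0 exps D that(3,4)])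
  qed
  show ?thesis
  proof (intro conjI impI)
    assume "1 < ess_inf p"
    then have "1 < p0" using p0(1) by simp
    obtain C where C: "0 < C"
      "\<And>(f :: real ^ 'n \<Rightarrow> real) F. f \<in> borel_measurable lebesgue \<Longrightarrow>
        (\<And>x t. 0 < t \<Longrightarrow> ennreal t < F x \<Longrightarrow> x \<in> superlevel (1 - \<beta>) f t) \<Longrightarrow>
        weighted_bound p0 \<beta> C f F"
      using strong_type[where 'a="real ^ 'n", OF \<beta> \<open>1 < p0\<close> p0\<beta>] by blast
    have "Lp_norm q (frac_maximal_fun \<alpha> f) \<le> ennreal (A C) * Lp_norm p (\<lambda>x. ennreal \<bar>f x\<bar>)"
      if f: "f \<in> Lp_space p" for f
    proof (rule bound[OF f _ C(1)])
      have fm: "f \<in> borel_measurable lebesgue" using f by (simp add: Lp_space_def)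
      show "weighted_bound p0 \<beta> C f (frac_maximal_fun \<alpha> f)"
        using superlevel_eq_frac_maximal_fun[of _ \<alpha> f] unfolding dim by (intro C(2)[OF fm]) auto
    qed measurable
    with A[OF C(1)] show "\<exists>C::real. 0 < C \<and> (\<forall>f \<in> Lp_space p.
              Lp_norm q (frac_maximal_fun \<alpha> f) \<le> ennreal C * Lp_norm p (\<lambda>x. ennreal \<bar>f x\<bar>))"
      by blast
  next
    assume "ess_inf p = 1"
    then have p01: "p0 = 1" using p0(1) by simp
    define C where "C = (5::real) ^ DIM(real ^ 'n)"
    have C: "0 < C" by (simp add: C_def)
    have "Lp_norm q (\<lambda>x. ennreal l * indicator {x. frac_maximal_fun \<alpha> f x > ennreal l} x)
        \<le> ennreal (A C) * Lp_norm p (\<lambda>x. ennreal \<bar>f x\<bar>)"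
      if f: "f \<in> Lp_space p" and l: "0 < l" for f l
    proof (rule bound[OF f _ C])
      have fm: "f \<in> borel_measurable lebesgue" using f by (simp add: Lp_space_def)
      have lev: "{x. frac_maximal_fun \<alpha> f x > ennreal l} = superlevel (1 - \<beta>) f l"
        using superlevel_eq_frac_maximal_fun[of l \<alpha> f] l unfolding dim by auto
      have [measurable]: "superlevel (1 - \<beta>) f l \<in> sets lebesgue"
        by (intro open_sets_lebesgue open_superlevel)
      show "(\<lambda>x. ennreal l * indicator {x. frac_maximal_fun \<alpha> f x > ennreal l} x) \<in> borel_measurable lebesgue"
        unfolding lev by measurable
      show "weighted_bound p0 \<beta> C f (\<lambda>x. ennreal l * indicator {x. frac_maximal_fun \<alpha> f x > ennreal l} x)"
        unfolding lev p01 C_def by (rule weak_type_endpoint[OF fm \<beta> l])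
    qed
    with A[OF C] show "\<exists>C::real. 0 < C \<and> (\<forall>f \<in> Lp_space p. \<forall>l::real. 0 < l \<longrightarrow>
              Lp_norm q (\<lambda>x. ennreal l * indicator {x. frac_maximal_fun \<alpha> f x > ennreal l} x)
                \<le> ennreal C * Lp_norm p (\<lambda>x. ennreal \<bar>f x\<bar>))"
      by blast
  qed
qed

end
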